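(* Let $\Omega$ be a smooth bounded domain in $\mathbb{R}^N$, $N\ge2$, which contains the origin, is symmetric with respect to the hyperplane $\{x_1=0\}$ and is convex in the $x_1$-direction. Let $a(s)=1+|s|^k$ with $k>1$, and let $\psi:\mathbb{R}^N\to(0,\infty)$ be continuous, even in the $x_1$-variable and increasing in the $x_1$-variable in $\{x\in\Omega:x_1<0\}$. Then, if $p>k+1$, any (smooth) solution $u$ to the problem $$\begin{cases}-\mathrm{div}(a(u)Du)+\frac{a'(u)}{2}|Du|^2=\psi(x)u^p&\text{in }\Omega,\\ u>0&\text{in }\Omega,\\ u=0&\text{on }\partial\Omega,\end{cases}$$ is symmetric with respect to $x_1$, that is, $u(-x_1,x_2,\dots,x_N)=u(x_1,x_2,\dots,x_N)$ for all $x\in\Omega$.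
   Context: A (smooth) solution is a classical solution $u\in C^2(\Omega)\cap C(\overline{\Omega})$. $Du$ denotes the gradient of $u$. Convex in the $x_1$-direction means that every segment parallel to the $x_1$-axis with endpoints in $\Omega$ is contained in $\Omega$. *)

theory Defs
  imports "HOL-Analysis.Analysis"
begin

definition partial_deriv :: "'n::finite \<Rightarrow> (real^'n \<Rightarrow> real) \<Rightarrow> real^'n \<Rightarrow> real" where
  "partial_deriv i f x = frechet_derivative f (at x) (axis i 1)"

definition gradient :: "(real^'n::finite \<Rightarrow> real) \<Rightarrow> real^'n \<Rightarrow> real^'n" where
  "gradient f x = (\<chi> i. partial_deriv i f x)"

definition divergence :: "(real^'n::finite \<Rightarrow> real^'n) \<Rightarrow> real^'n \<Rightarrow> real" where
  "divergence F x = (\<Sum>i\<in>UNIV. partial_deriv i (\<lambda>y. F y $ i) x)"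

text \<open>The next two notions are meant for open \<open>S\<close> only, since derivatives are taken
  with respect to full neighbourhoods.\<close>

primrec C_on :: "nat \<Rightarrow> (real^'n::finite) set \<Rightarrow> (real^'n \<Rightarrow> real) \<Rightarrow> bool" where
  "C_on 0 S f \<longleftrightarrow> continuous_on S f"
| "C_on (Suc m) S f \<longleftrightarrow>
     (\<forall>x\<in>S. f differentiable (at x)) \<and> (\<forall>i. C_on m S (partial_deriv i f))"

definition smooth_on :: "(real^'n::finite) set \<Rightarrow> (real^'n \<Rightarrow> real) \<Rightarrow> bool" where
  "smooth_on S f \<longleftrightarrow> (\<forall>m. C_on m S f)"

text \<open>\<open>C\<^sup>\<infinity>\<close> boundary: near each boundary point, after relabelling and reorienting the
  coordinate axes, \<open>\<Omega>\<close> is the set above the graph of a smooth function of the other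
  \<open>N - 1\<close> coordinates. Such a function is represented as a smooth \<open>g\<close> on the whole space
  that does not depend on the \<open>j\<close>-th coordinate.\<close>

definition smooth_boundary :: "(real^'n::finite) set \<Rightarrow> bool" where
  "smooth_boundary \<Omega> \<longleftrightarrow>
     (\<forall>z\<in>frontier \<Omega>. \<exists>r>0. \<exists>j. \<exists>\<sigma>\<in>{-1, 1}. \<exists>g.
        smooth_on UNIV g \<and>
        (\<forall>x y. (\<forall>i. i \<noteq> j \<longrightarrow> x $ i = y $ i) \<longrightarrow> g x = g y) \<and>
        \<Omega> \<inter> ball z r = {x \<in> ball z r. \<sigma> * x $ j > g x})"

definition smooth_bounded_domain :: "(real^'n::finite) set \<Rightarrow> bool" where
  "smooth_bounded_domain \<Omega> \<longleftrightarrow>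
     open \<Omega> \<and> connected \<Omega> \<and> \<Omega> \<noteq> {} \<and> bounded \<Omega> \<and> smooth_boundary \<Omega>"

definition reflect :: "'n::finite \<Rightarrow> real^'n \<Rightarrow> real^'n" where
  "reflect j x = (\<chi> i. if i = j then - x $ i else x $ i)"

definition convex_in_direction :: "'n::finite \<Rightarrow> (real^'n) set \<Rightarrow> bool" where
  "convex_in_direction j S \<longleftrightarrow>
     (\<forall>x\<in>S. \<forall>y\<in>S. (\<forall>i. i \<noteq> j \<longrightarrow> x $ i = y $ i) \<longrightarrow> closed_segment x y \<subseteq> S)"

text \<open>``Increasing'' is understood in the non-strict sense.\<close>

definition increasing_in_coordinate_on ::
    "'n::finite \<Rightarrow> (real^'n) set \<Rightarrow> (real^'n \<Rightarrow> real) \<Rightarrow> bool" where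
  "increasing_in_coordinate_on j S f \<longleftrightarrow>
     (\<forall>x\<in>S. \<forall>y\<in>S. (\<forall>i. i \<noteq> j \<longrightarrow> x $ i = y $ i) \<longrightarrow> x $ j \<le> y $ j \<longrightarrow> f x \<le> f y)"

definition classical_solution ::
    "(real^'n::finite) set \<Rightarrow> (real \<Rightarrow> real) \<Rightarrow> (real^'n \<Rightarrow> real) \<Rightarrow> real \<Rightarrow> (real^'n \<Rightarrow> real) \<Rightarrow> bool"
  where
  "classical_solution \<Omega> a \<psi> p u \<longleftrightarrow>
     C_on 2 \<Omega> u \<and> continuous_on (closure \<Omega>) u \<and>
     (\<forall>x\<in>\<Omega>. - divergence (\<lambda>y. a (u y) *\<^sub>R gradient u y) x
              + deriv a (u x) / 2 * (norm (gradient u x))\<^sup>2 = \<psi> x * u x powr p) \<and>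
     (\<forall>x\<in>\<Omega>. u x > 0) \<and>
     (\<forall>x\<in>frontier \<Omega>. u x = 0)"

end

theory Submission
  imports Defs
begin

text \<open>Two ideas carry the proof: a change of the unknown that removes the gradient term, and the
  method of moving planes for the resulting semilinear equation.

  The factor \<open>1/2\<close> in front of \<open>a'(u) |Du|\<^sup>2\<close> is the one for which the gradient
  disappears under \<open>v = G(u)\<close> with \<open>G' = \<surd>a\<close> and \<open>G(0) = 0\<close>: the left-hand side is
  \<open>- a(u) \<Delta>u - a'(u)/2 |Du|\<^sup>2 = - \<surd>a(u) \<Delta>v\<close>, so that \<open>- \<Delta>v = \<psi> h(v)\<close> with
  \<open>h(G(s)) = s\<^sup>p / \<surd>a(s)\<close> (\<open>laplacian_of_transform\<close>). On the range of a bounded solution \<open>h\<close> is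
  nonnegative and Lipschitz, the latter because \<open>s\<^sup>p / \<surd>a(s)\<close> is Lipschitz and \<open>G\<close> does not
  contract distances. Since \<open>G\<close> is injective, symmetry of \<open>v\<close> gives symmetry of \<open>u\<close>.

  For \<open>\<mu> < 0\<close> let the cap be the part of \<open>\<Omega>\<close> below the hyperplane \<open>x\<^sub>1 = \<mu>\<close> and compare \<open>v\<close> on
  it with its mirror image: \<open>w = v \<circ> mirror - v\<close>. Monotonicity of \<open>\<psi>\<close> and the properties of \<open>h\<close>
  give \<open>\<Delta>w \<le> C |w|\<close>, and \<open>w \<ge> 0\<close> on the boundary of the cap. The claim is \<open>w \<ge> 0\<close> for every
  \<open>\<mu> < 0\<close>; letting \<open>\<mu>\<close> tend to \<open>0\<close> then gives \<open>v(x) \<le> v(reflect x)\<close> for \<open>x\<^sub>1 < 0\<close>, and the same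
  statement for the solution \<open>v \<circ> reflect\<close> is the opposite inequality.

  Suppose the claim fails and let \<open>\<nu>\<close> be the infimum of the bad \<open>\<mu>\<close>. By continuity \<open>w \<ge> 0\<close> at
  \<open>\<nu>\<close>, and there are bad \<open>\<mu>\<^sub>n\<close> tending to \<open>\<nu>\<close>. Let \<open>x\<^sub>n\<close> minimise \<open>w\<close> over the closed cap
  at \<open>\<mu>\<^sub>n\<close>, with negative value, and let \<open>x\<close> be a limit point of the \<open>x\<^sub>n\<close>. If \<open>x\<close> lies inside the
  cap at \<open>\<nu>\<close>, then \<open>w(x) \<le> 0\<close> there, against the strong maximum principle (\<open>gap_pos\<close>). Otherwise
  \<open>x\<close> lies on the hyperplane or on the boundary of \<open>\<Omega>\<close>, and at every small scale there is a ball
  near \<open>x\<close>, of comparable radius, that misses the caps at \<open>\<mu>\<^sub>n\<close> for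
  large \<open>n\<close>; a barrier centred in this ball shows that a negative minimum cannot lie so close to it (\<open>negative_minimum_not_near_complement\<close>). This
  barrier argument takes the place of the maximum principle for domains of small measure: no
  integral estimate is needed, only the second derivative test at minimum points.

  The exterior balls at the boundary of \<open>\<Omega>\<close> exist because the boundary is locally a Lipschitz
  graph (\<open>smooth_boundary_corkscrew\<close>).\<close>

section \<open>Laplacians computed along coordinate lines\<close>

text \<open>A pointwise one-dimensional notion: it asks for a derivative near \<open>t\<close> and a second derivative
  at \<open>t\<close> alone. It is just strong enough for the second derivative test, and it turns sums,
  reflections and compositions into one-variable calculus.\<close>

definition has_second_deriv :: "(real \<Rightarrow> real) \<Rightarrow> real \<Rightarrow> real \<Rightarrow> bool" where
  "has_second_deriv f D t \<longleftrightarrow>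
     (\<exists>f'. (\<forall>\<^sub>F s in nhds t. (f has_real_derivative f' s) (at s)) \<and>
           (f' has_real_derivative D) (at t))"

definition has_laplacian :: "(real^'n::finite \<Rightarrow> real) \<Rightarrow> real \<Rightarrow> real^'n \<Rightarrow> bool" where
  "has_laplacian f D x \<longleftrightarrow>
     (\<exists>d. (\<forall>i. has_second_deriv (\<lambda>t. f (x + t *\<^sub>R axis i 1)) (d i) 0) \<and> D = (\<Sum>i\<in>UNIV. d i))"

lemma has_second_deriv_diff:
  assumes "has_second_deriv f D t" "has_second_deriv g E t"
  shows "has_second_deriv (\<lambda>s. f s - g s) (D - E) t"
proof -
  obtain f' where f: "\<forall>\<^sub>F s in nhds t. (f has_real_derivative f' s) (at s)"
      "(f' has_real_derivative D) (at t)"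
    using assms(1) unfolding has_second_deriv_def by blast
  obtain g' where g: "\<forall>\<^sub>F s in nhds t. (g has_real_derivative g' s) (at s)"
      "(g' has_real_derivative E) (at t)"
    using assms(2) unfolding has_second_deriv_def by blast
  have "\<forall>\<^sub>F s in nhds t. ((\<lambda>s. f s - g s) has_real_derivative (f' s - g' s)) (at s)"
    using f(1) g(1) by eventually_elim (rule DERIV_diff)
  moreover have "((\<lambda>s. f' s - g' s) has_real_derivative (D - E)) (at t)"
    using f(2) g(2) by (rule DERIV_diff)
  ultimately show ?thesis
    unfolding has_second_deriv_def by (intro exI[of _ "\<lambda>s. f' s - g' s"]) blast
qed

lemma has_second_deriv_cmult:
  assumes "has_second_deriv f D t"
  shows "has_second_deriv (\<lambda>s. c * f s) (c * D) t"
proof -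
  obtain f' where f: "\<forall>\<^sub>F s in nhds t. (f has_real_derivative f' s) (at s)"
      "(f' has_real_derivative D) (at t)"
    using assms(1) unfolding has_second_deriv_def by blast
  have "\<forall>\<^sub>F s in nhds t. ((\<lambda>s. c * f s) has_real_derivative (c * f' s)) (at s)"
    using f(1) by eventually_elim (rule DERIV_cmult)
  moreover have "((\<lambda>s. c * f' s) has_real_derivative (c * D)) (at t)"
    using f(2) by (rule DERIV_cmult)
  ultimately show ?thesis
    unfolding has_second_deriv_def by (intro exI[of _ "\<lambda>s. c * f' s"]) blast
qed

lemma has_second_deriv_const: "has_second_deriv (\<lambda>s. c) 0 t"
  unfolding has_second_deriv_def by (intro exI[of _ "\<lambda>s. 0"]) auto

lemma has_second_deriv_reverse:
  assumes "has_second_deriv f D 0"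
  shows "has_second_deriv (\<lambda>s. f (- s)) D 0"
proof -
  obtain f' where f: "\<forall>\<^sub>F s in nhds 0. (f has_real_derivative f' s) (at s)"
      "(f' has_real_derivative D) (at 0)"
    using assms(1) unfolding has_second_deriv_def by blast
  have lim: "filterlim (\<lambda>s::real. - s) (nhds 0) (nhds 0)"
    using tendsto_minus[of "\<lambda>s. s" 0 "nhds (0::real)"] by (simp add: filterlim_ident)
  have "\<forall>\<^sub>F s in nhds 0. (f has_real_derivative f' (- s)) (at (- s))"
    using eventually_compose_filterlim[OF f(1) lim] .
  then have "\<forall>\<^sub>F s in nhds 0. ((\<lambda>s. f (- s)) has_real_derivative (- f' (- s))) (at s)"
    by eventually_elim (simp add: DERIV_mirror)
  moreover have "((\<lambda>s. - f' (- s)) has_real_derivative D) (at 0)"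
    using DERIV_minus[of "\<lambda>s. f' (- s)" "- D" 0] f(2) DERIV_mirror[of f' D 0] by simp
  ultimately show ?thesis
    unfolding has_second_deriv_def by (intro exI[of _ "\<lambda>s. - f' (- s)"]) blast
qed

text \<open>If the second derivative were negative, the first derivative, which vanishes at \<open>t\<close>, would be
  negative just to the right of \<open>t\<close>, and the mean value theorem would give a smaller value there.\<close>

lemma has_second_deriv_local_min:
  assumes "has_second_deriv f D t" "\<forall>\<^sub>F s in nhds t. f t \<le> f s"
  shows "0 \<le> D"
proof (rule ccontr)
  assume "\<not> 0 \<le> D"
  obtain f' where f: "\<forall>\<^sub>F s in nhds t. (f has_real_derivative f' s) (at s)"
      "(f' has_real_derivative D) (at t)"
    using assms(1) unfolding has_second_deriv_def by blast
  have "\<forall>\<^sub>F s in nhds t. (f has_real_derivative f' s) (at s) \<and> f t \<le> f s"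
    using f(1) assms(2) by eventually_elim blast
  then obtain e where e: "0 < e"
      "\<And>s. dist s t < e \<Longrightarrow> (f has_real_derivative f' s) (at s) \<and> f t \<le> f s"
    unfolding eventually_nhds_metric by blast
  have "f' t = 0"
    using DERIV_local_min[of f "f' t" t e] e by (auto simp: dist_real_def abs_minus_commute)
  moreover obtain d where d: "0 < d" "\<And>h. 0 < h \<Longrightarrow> h < d \<Longrightarrow> f' (t + h) < f' t"
    using DERIV_neg_dec_right[OF f(2)] \<open>\<not> 0 \<le> D\<close> by (auto simp: not_le)
  moreover define h where "h = min d e / 2"
  ultimately have h: "0 < h" "h < d" "h < e" "f' t = 0" using e(1) by auto
  obtain z where z: "t < z" "z < t + h" "f (t + h) - f t = (t + h - t) * f' z"
    using MVT2[of t "t + h" f f'] h e(2) by (auto simp: dist_real_def)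
  have "f' z < 0" using d(2)[of "z - t"] z h by auto
  then have "f (t + h) < f t" using z(3) h(1) mult_pos_neg[of h "f' z"] by simp
  moreover have "f t \<le> f (t + h)" using e(2)[of "t + h"] h by (auto simp: dist_real_def)
  ultimately show False by simp
qed

lemma has_second_deriv_compose:
  assumes "has_second_deriv f D t" "(f has_real_derivative d) (at t)"
    and "\<forall>\<^sub>F s in nhds (f t). (g has_real_derivative g' s) (at s)"
    and "(g' has_real_derivative E) (at (f t))"
  shows "has_second_deriv (\<lambda>s. g (f s)) (E * d\<^sup>2 + g' (f t) * D) t"
proof -
  obtain f' where f: "\<forall>\<^sub>F s in nhds t. (f has_real_derivative f' s) (at s)"
      "(f' has_real_derivative D) (at t)"
    using assms(1) unfolding has_second_deriv_def by blast
  have d: "f' t = d"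
    using eventually_nhds_x_imp_x[OF f(1)] assms(2) DERIV_unique by blast
  have "isCont f t" using assms(2) DERIV_isCont by blast
  then have "filterlim f (nhds (f t)) (nhds t)"
    by (simp add: tendsto_nhds_iff isCont_def)
  from eventually_compose_filterlim[OF assms(3) this] f(1)
  have "\<forall>\<^sub>F s in nhds t. ((\<lambda>s. g (f s)) has_real_derivative (g' (f s) * f' s)) (at s)"
    by eventually_elim (rule DERIV_chain2)
  moreover have "((\<lambda>s. g' (f s) * f' s) has_real_derivative (E * d\<^sup>2 + g' (f t) * D)) (at t)"
    using DERIV_mult[OF DERIV_chain2[OF assms(4) assms(2)] f(2)]
    by (simp add: d power2_eq_square algebra_simps)
  ultimately show ?thesis
    unfolding has_second_deriv_def by (intro exI[of _ "\<lambda>s. g' (f s) * f' s"]) blast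
qed

lemma has_laplacian_diff:
  assumes "has_laplacian f D x" "has_laplacian g E x"
  shows "has_laplacian (\<lambda>x. f x - g x) (D - E) x"
proof -
  obtain d e where "\<forall>i. has_second_deriv (\<lambda>t. f (x + t *\<^sub>R axis i 1)) (d i) 0" "D = sum d UNIV"
    "\<forall>i. has_second_deriv (\<lambda>t. g (x + t *\<^sub>R axis i 1)) (e i) 0" "E = sum e UNIV"
    using assms unfolding has_laplacian_def by auto
  then show ?thesis
    unfolding has_laplacian_def
    by (intro exI[of _ "\<lambda>i. d i - e i"]) (auto intro: has_second_deriv_diff simp: sum_subtractf)
qed

lemma has_laplacian_cmult:
  assumes "has_laplacian f D x"
  shows "has_laplacian (\<lambda>x. c * f x) (c * D) x"
proof -
  obtain d where "\<forall>i. has_second_deriv (\<lambda>t. f (x + t *\<^sub>R axis i 1)) (d i) 0" "D = sum d UNIV"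
    using assms unfolding has_laplacian_def by auto
  then show ?thesis
    unfolding has_laplacian_def
    by (intro exI[of _ "\<lambda>i. c * d i"]) (auto intro: has_second_deriv_cmult simp: sum_distrib_left)
qed

lemma has_laplacian_const: "has_laplacian (\<lambda>x. c) 0 x"
  unfolding has_laplacian_def
  by (intro exI[of _ "\<lambda>i. 0"]) (auto intro: has_second_deriv_const)

lemma has_laplacian_local_min:
  assumes "has_laplacian f D x" "\<forall>\<^sub>F y in nhds x. f x \<le> f y"
  shows "0 \<le> D"
proof -
  obtain d where d: "\<And>i. has_second_deriv (\<lambda>t. f (x + t *\<^sub>R axis i 1)) (d i) 0" "D = sum d UNIV"
    using assms unfolding has_laplacian_def by auto
  have "0 \<le> d i" for i
  proof (rule has_second_deriv_local_min[OF d(1)])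
    have "isCont (\<lambda>t. x + t *\<^sub>R axis i 1) 0" by (intro continuous_intros)
    then have "filterlim (\<lambda>t. x + t *\<^sub>R axis i 1) (nhds x) (nhds 0)"
      by (simp add: tendsto_nhds_iff isCont_def)
    from eventually_compose_filterlim[OF assms(2) this]
    show "\<forall>\<^sub>F t in nhds 0. f (x + 0 *\<^sub>R axis i 1) \<le> f (x + t *\<^sub>R axis i 1)" by simp
  qed
  then show ?thesis using d(2) by (simp add: sum_nonneg)
qed

text \<open>The form in which the second derivative test is used below: boundary conditions and the
  differential inequality both appear as properties of the points where \<open>f\<close> is negative, because
  the comparison functions satisfy their differential inequalities only there.\<close>

lemma minimum_principle:
  fixes f :: "real^'n::finite \<Rightarrow> real"
  assumes "compact Q" "continuous_on Q f" "x \<in> Q"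
    and "\<And>q. q \<in> Q \<Longrightarrow> f q < 0 \<Longrightarrow> q \<in> interior Q \<and> (\<exists>D<0. has_laplacian f D q)"
  shows "0 \<le> f x"
proof (rule ccontr)
  assume "\<not> 0 \<le> f x"
  obtain q where q: "q \<in> Q" "\<And>y. y \<in> Q \<Longrightarrow> f q \<le> f y"
    using continuous_attains_inf[OF assms(1) _ assms(2)] assms(3) by blast
  then have "f q < 0" using assms(3) \<open>\<not> 0 \<le> f x\<close> by fastforce
  then obtain D where D: "D < 0" "has_laplacian f D q" "q \<in> interior Q" using assms(4) q by blast
  have "\<forall>\<^sub>F y in nhds q. y \<in> interior Q" using D(3) by (simp add: eventually_nhds_in_open)
  then have "\<forall>\<^sub>F y in nhds q. f q \<le> f y"
    by eventually_elim (use q(2) interior_subset in blast)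
  then show False using has_laplacian_local_min[OF D(2)] D(1) by fastforce
qed

section \<open>Exponential barriers\<close>

text \<open>The barrier vanishes on the sphere of radius \<open>R\<close> about \<open>y\<close>, is positive inside, and is strictly
  subharmonic away from \<open>y\<close> once \<open>\<tau>\<close> is large.\<close>

definition barrier :: "real \<Rightarrow> real^'n::finite \<Rightarrow> real \<Rightarrow> real^'n \<Rightarrow> real" where
  "barrier \<tau> y R x = exp (- \<tau> * (norm (x - y))\<^sup>2) - exp (- \<tau> * R\<^sup>2)"

lemma barrier_pos: "0 < \<tau> \<Longrightarrow> norm (x - y) < R \<Longrightarrow> 0 < barrier \<tau> y R x"
  by (simp add: barrier_def power_strict_mono)

lemma barrier_less_1: "0 < \<tau> \<Longrightarrow> barrier \<tau> y R x < 1"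
  unfolding barrier_def
  by (smt (verit) exp_gt_zero exp_le_one_iff mult_nonneg_nonneg zero_le_power2 mult_minus_left)

lemma has_laplacian_barrier:
  fixes x y :: "real^'n::finite"
  shows "has_laplacian (barrier \<tau> y R)
    ((4 * \<tau>\<^sup>2 * (norm (x - y))\<^sup>2 - 2 * real CARD('n) * \<tau>) * exp (- \<tau> * (norm (x - y))\<^sup>2)) x"
proof -
  define A where "A = (norm (x - y))\<^sup>2"
  define b where "b i = x $ i - y $ i" for i
  have line: "barrier \<tau> y R (x + t *\<^sub>R axis i 1)
      = exp (- \<tau> * (A + 2 * t * b i + t\<^sup>2)) - exp (- \<tau> * R\<^sup>2)" for t i
  proof -
    have "(norm (x + t *\<^sub>R axis i 1 - y))\<^sup>2 = A + 2 * t * b i + t\<^sup>2"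
      unfolding A_def b_def power2_norm_eq_inner
      by (simp add: inner_add_left inner_add_right inner_diff_left inner_diff_right
          inner_axis inner_axis' power2_eq_square algebra_simps)
    then show ?thesis by (simp add: barrier_def)
  qed
  have "has_second_deriv (\<lambda>t. barrier \<tau> y R (x + t *\<^sub>R axis i 1))
      ((4 * \<tau>\<^sup>2 * (b i)\<^sup>2 - 2 * \<tau>) * exp (- \<tau> * A)) 0" for i
    unfolding has_second_deriv_def line
  proof (intro exI conjI always_eventually allI)
    show "((\<lambda>t. exp (- \<tau> * (A + 2 * t * b i + t\<^sup>2)) - exp (- \<tau> * R\<^sup>2)) has_real_derivative
        - \<tau> * (2 * b i + 2 * t) * exp (- \<tau> * (A + 2 * t * b i + t\<^sup>2))) (at t)" for t
      by (auto intro!: derivative_eq_intros simp: algebra_simps)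
    show "((\<lambda>t. - \<tau> * (2 * b i + 2 * t) * exp (- \<tau> * (A + 2 * t * b i + t\<^sup>2))) has_real_derivative
        (4 * \<tau>\<^sup>2 * (b i)\<^sup>2 - 2 * \<tau>) * exp (- \<tau> * A)) (at 0)"
      by (auto intro!: derivative_eq_intros simp: algebra_simps power2_eq_square)
  qed
  moreover have "(\<Sum>i\<in>UNIV. (4 * \<tau>\<^sup>2 * (b i)\<^sup>2 - 2 * \<tau>) * exp (- \<tau> * A))
      = (4 * \<tau>\<^sup>2 * A - 2 * real CARD('n) * \<tau>) * exp (- \<tau> * A)"
  proof -
    have "(\<Sum>i\<in>UNIV. (b i)\<^sup>2) = A"
      unfolding A_def b_def power2_norm_eq_inner inner_vec_def by (simp add: power2_eq_square)
    then show ?thesis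
      by (simp add: sum_distrib_right[symmetric] sum_subtractf sum_distrib_left[symmetric])
  qed
  ultimately show ?thesis unfolding has_laplacian_def A_def[symmetric]
    by (intro exI[of _ "\<lambda>i. (4 * \<tau>\<^sup>2 * (b i)\<^sup>2 - 2 * \<tau>) * exp (- \<tau> * A)"]) auto
qed

lemma continuous_on_barrier: "continuous_on S (barrier \<tau> y R)"
  unfolding barrier_def by (intro continuous_intros)


section \<open>Reflections in parallel hyperplanes\<close>

definition mirror :: "real \<Rightarrow> 'n::finite \<Rightarrow> real^'n \<Rightarrow> real^'n" where
  "mirror \<mu> j x = (\<chi> i. if i = j then 2 * \<mu> - x $ i else x $ i)"

lemma mirror_nth: "mirror \<mu> j x $ i = (if i = j then 2 * \<mu> - x $ i else x $ i)"
  by (simp add: mirror_def)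

lemma reflect_nth: "reflect j x $ i = (if i = j then - x $ i else x $ i)"
  by (simp add: reflect_def)

lemma mirror_0: "mirror 0 j = reflect j"
  by (simp add: fun_eq_iff vec_eq_iff mirror_nth reflect_nth)

lemma reflect_reflect: "reflect j (reflect j x) = x"
  by (simp add: vec_eq_iff reflect_nth)

lemma continuous_mirror:
  assumes "continuous F f" "continuous F g"
  shows "continuous F (\<lambda>t. mirror (f t) j (g t))"
proof -
  have "continuous F (\<lambda>t. if i = j then 2 * f t - g t $ i else g t $ i)" for i
    using assms by (cases "i = j") (auto intro!: continuous_intros)
  then show ?thesis
    unfolding mirror_def continuous_def by (intro vec_tendstoI) auto
qed

lemma continuous_on_mirror: "continuous_on S (mirror \<mu> j)"
  unfolding continuous_on_eq_continuous_within
  by (intro ballI continuous_mirror[where f = "\<lambda>_. \<mu>" and g = "\<lambda>x. x"]) auto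

lemma has_laplacian_mirror:
  assumes "has_laplacian f D (mirror \<mu> j x)"
  shows "has_laplacian (\<lambda>x. f (mirror \<mu> j x)) D x"
proof -
  obtain d where d: "\<And>i. has_second_deriv (\<lambda>t. f (mirror \<mu> j x + t *\<^sub>R axis i 1)) (d i) 0"
      "D = sum d UNIV"
    using assms unfolding has_laplacian_def by blast
  have "has_second_deriv (\<lambda>t. f (mirror \<mu> j (x + t *\<^sub>R axis i 1))) (d i) 0" for i
  proof (cases "i = j")
    case True
    have "mirror \<mu> j (x + t *\<^sub>R axis i 1) = mirror \<mu> j x + (- t) *\<^sub>R axis i 1" for t
      using True by (simp add: vec_eq_iff mirror_nth axis_def)
    then show ?thesis using has_second_deriv_reverse[OF d(1)[of i]] by simp
  next
    case False
    then have "mirror \<mu> j (x + t *\<^sub>R axis i 1) = mirror \<mu> j x + t *\<^sub>R axis i 1" for t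
      by (simp add: vec_eq_iff mirror_nth axis_def)
    then show ?thesis using d(1)[of i] by simp
  qed
  then show ?thesis unfolding has_laplacian_def using d(2) by blast
qed

section \<open>The moving plane method\<close>

text \<open>The hypothesis on exterior balls is only required at each boundary point separately, with
  constants that may depend on the point; the compactness argument below supplies the point.\<close>

locale moving_planes =
  fixes \<Omega> :: "(real^'n::finite) set" and j :: 'n
    and \<psi> v :: "real^'n \<Rightarrow> real" and h :: "real \<Rightarrow> real" and L :: real
  assumes open_domain: "open \<Omega>" and bounded_domain: "bounded \<Omega>"
    and symmetric: "reflect j ` \<Omega> = \<Omega>"
    and convex_direction: "convex_in_direction j \<Omega>"
    and corkscrew: "\<And>z. z \<in> frontier \<Omega> \<Longrightarrow>
      \<exists>c>0. \<exists>r>0. \<forall>t. 0 < t \<longrightarrow> t < r \<longrightarrow> (\<exists>y. dist z y \<le> t \<and> ball y (c * t) \<inter> \<Omega> = {})"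
    and weight_continuous: "continuous_on UNIV \<psi>"
    and weight_pos: "\<And>x. 0 < \<psi> x"
    and weight_even: "\<And>x. \<psi> (reflect j x) = \<psi> x"
    and weight_increasing: "increasing_in_coordinate_on j {x \<in> \<Omega>. x $ j < 0} \<psi>"
    and v_continuous: "continuous_on (closure \<Omega>) v"
    and v_pos: "\<And>x. x \<in> \<Omega> \<Longrightarrow> 0 < v x"
    and v_frontier: "\<And>x. x \<in> frontier \<Omega> \<Longrightarrow> v x = 0"
    and v_laplacian: "\<And>x. x \<in> \<Omega> \<Longrightarrow> has_laplacian v (- (\<psi> x * h (v x))) x"
    and h_nonneg: "\<And>x. x \<in> \<Omega> \<Longrightarrow> 0 \<le> h (v x)"
    and h_lipschitz: "L-lipschitz_on (v ` \<Omega>) h"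
begin

definition cap :: "real \<Rightarrow> (real^'n) set" where
  "cap \<mu> = {x \<in> \<Omega>. x $ j < \<mu>}"

definition gap :: "real \<Rightarrow> real^'n \<Rightarrow> real" where
  "gap \<mu> x = v (mirror \<mu> j x) - v x"

lemma v_nonneg: "x \<in> closure \<Omega> \<Longrightarrow> 0 \<le> v x"
  using v_pos[of x] v_frontier[of x] open_domain
  by (cases "x \<in> \<Omega>") (auto simp: frontier_def interior_open)

text \<open>The line through \<open>p\<close> in the distinguished direction meets \<open>\<Omega>\<close> in a set that contains \<open>p\<close>, its
  reflection, and hence the segment between them. The mirror image of a cap therefore stays in \<open>\<Omega>\<close>.\<close>

lemma mem_of_smaller_height:
  assumes "p \<in> \<Omega>" "\<And>i. i \<noteq> j \<Longrightarrow> q $ i = p $ i" "\<bar>q $ j\<bar> \<le> \<bar>p $ j\<bar>"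
  shows "q \<in> \<Omega>"
proof (cases "p $ j = 0")
  case True
  then have "q = p" using assms by (metis abs_le_zero_iff abs_zero vec_eq_iff)
  then show ?thesis using assms by simp
next
  case False
  have "reflect j p \<in> \<Omega>" using symmetric assms(1) by blast
  moreover have "closed_segment p (reflect j p) \<subseteq> \<Omega>"
    using convex_direction assms(1) calculation
    unfolding convex_in_direction_def by (auto simp: reflect_nth)
  \<comment> \<open>the parameter of \<open>q\<close> on the segment from \<open>p\<close>, at \<open>0\<close>, to its reflection, at \<open>1\<close>\<close>
  moreover define s where "s = (p $ j - q $ j) / (2 * p $ j)"
  have "0 \<le> s" "s \<le> 1" using assms(3) False
    by (auto simp: s_def field_simps abs_if split: if_splits)
  moreover have "q = (1 - s) *\<^sub>R p + s *\<^sub>R reflect j p"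
    unfolding vec_eq_iff
  proof
    fix i show "q $ i = ((1 - s) *\<^sub>R p + s *\<^sub>R reflect j p) $ i"
      using assms(2)[of i] False by (cases "i = j") (auto simp: reflect_nth s_def field_simps)
  qed
  ultimately show ?thesis unfolding closed_segment_def by blast
qed

lemma mirror_mem: "\<mu> < 0 \<Longrightarrow> x \<in> cap \<mu> \<Longrightarrow> mirror \<mu> j x \<in> \<Omega>"
  by (rule mem_of_smaller_height[of x]) (auto simp: cap_def mirror_nth)

lemma open_cap: "open (cap \<mu>)"
proof -
  have "cap \<mu> = \<Omega> \<inter> {x. x $ j < \<mu>}" by (auto simp: cap_def)
  then show ?thesis using open_domain open_halfspace_component_lt_cart by auto
qed

lemma closure_cap: "closure (cap \<mu>) \<subseteq> {x \<in> closure \<Omega>. x $ j \<le> \<mu>}"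
proof -
  have "closure (cap \<mu>) \<subseteq> closure \<Omega>" by (rule closure_mono) (auto simp: cap_def)
  moreover have "closure (cap \<mu>) \<subseteq> {x. x $ j \<le> \<mu>}"
    by (rule closure_minimal) (auto simp: cap_def closed_halfspace_component_le_cart)
  ultimately show ?thesis by auto
qed

lemma compact_closure_cap: "compact (closure (cap \<mu>))"
  by (metis (no_types, lifting) bounded_domain bounded_subset cap_def compact_closure mem_Collect_eq subsetI)

lemma mirror_mem_closure:
  assumes "\<mu> < 0" "x \<in> closure (cap \<mu>)"
  shows "mirror \<mu> j x \<in> closure \<Omega>"
proof -
  have "mirror \<mu> j ` closure (cap \<mu>) \<subseteq> closure \<Omega>"
    using mirror_mem[OF assms(1)] closure_subset
    by (intro image_closure_subset continuous_on_mirror) auto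
  then show ?thesis using assms(2) by blast
qed

lemma continuous_on_gap: "\<mu> < 0 \<Longrightarrow> continuous_on (closure (cap \<mu>)) (gap \<mu>)"
  unfolding gap_def
  by (intro continuous_on_diff continuous_on_compose2[OF v_continuous continuous_on_mirror]
      continuous_on_subset[OF v_continuous]) (use mirror_mem_closure closure_cap in auto)

text \<open>The boundary of the cap consists of points of the hyperplane, where the gap is zero, and points
  of the boundary of \<open>\<Omega>\<close>, where \<open>v\<close> vanishes while its mirror image is nonnegative.\<close>

lemma gap_nonneg_outside_cap:
  assumes "\<mu> < 0" "x \<in> closure (cap \<mu>)" "x \<notin> cap \<mu>"
  shows "0 \<le> gap \<mu> x"
proof (cases "x \<in> \<Omega>")
  case True
  then have "x $ j = \<mu>" using assms closure_cap by (fastforce simp: cap_def)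
  then have "mirror \<mu> j x = x" by (auto simp: vec_eq_iff mirror_nth)
  then show ?thesis by (simp add: gap_def)
next
  case False
  then have "x \<in> frontier \<Omega>"
    using assms closure_cap open_domain by (auto simp: frontier_def interior_open)
  then show ?thesis
    using v_frontier v_nonneg[OF mirror_mem_closure[OF assms(1,2)]] by (simp add: gap_def)
qed

text \<open>Continuity extends the monotonicity of the weight to the symmetry hyperplane itself, where the
  monotonicity hypothesis says nothing.\<close>

lemma weight_mono_closed:
  assumes "x \<in> \<Omega>" "y \<in> \<Omega>" "\<And>i. i \<noteq> j \<Longrightarrow> x $ i = y $ i" "x $ j < y $ j" "y $ j \<le> 0"
  shows "\<psi> x \<le> \<psi> y"
proof -
  \<comment> \<open>points on the segment from \<open>x\<close> to \<open>y\<close>, strictly before \<open>y\<close>, that converge to \<open>y\<close>\<close>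
  define s where "s n = y - (1 / real (Suc n)) *\<^sub>R (y - x)" for n
  have lim: "s \<longlonglongrightarrow> y"
  proof -
    have "(\<lambda>n. y - (1 / real (Suc n)) *\<^sub>R (y - x)) \<longlonglongrightarrow> y - 0 *\<^sub>R (y - x)"
      by (intro tendsto_intros LIMSEQ_Suc lim_1_over_n)
    then show ?thesis by (simp add: s_def[abs_def])
  qed
  have "\<psi> x \<le> \<psi> (s n)" for n
  proof -
    have sj: "s n $ j = y $ j - (1 / real (Suc n)) * (y $ j - x $ j)" by (simp add: s_def)
    have "0 < (1 / real (Suc n)) * (y $ j - x $ j)" using assms(4) by simp
    moreover have "(1 / real (Suc n)) * (y $ j - x $ j) \<le> y $ j - x $ j"
      using assms(4) by (simp add: divide_le_eq mult_le_cancel_left1)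
    ultimately have j: "x $ j \<le> s n $ j" "s n $ j < 0" using sj assms(5) by linarith+
    have other: "i \<noteq> j \<Longrightarrow> s n $ i = x $ i" for i using assms(3)[of i] by (simp add: s_def)
    have "s n \<in> \<Omega>" by (rule mem_of_smaller_height[OF assms(1) other]) (use j in auto)
    then show ?thesis
      using weight_increasing assms(1,4,5) j other unfolding increasing_in_coordinate_on_def by auto
  qed
  moreover have "(\<lambda>n. \<psi> (s n)) \<longlonglongrightarrow> \<psi> y"
    using weight_continuous lim continuous_on_tendsto_compose[of UNIV \<psi> s y] by simp
  ultimately show ?thesis by (intro LIMSEQ_le_const[of _ "\<psi> y"]) auto
qed

lemma weight_mirror_ge:
  assumes "\<mu> < 0" "x \<in> cap \<mu>"
  shows "\<psi> x \<le> \<psi> (mirror \<mu> j x)"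
proof (cases "2 * \<mu> - x $ j \<le> 0")
  case True
  then show ?thesis
    using assms by (intro weight_mono_closed mirror_mem) (auto simp: cap_def mirror_nth)
next
  case False
  have "reflect j (mirror \<mu> j x) \<in> \<Omega>" using mirror_mem[OF assms] symmetric by blast
  then have "\<psi> x \<le> \<psi> (reflect j (mirror \<mu> j x))"
    using assms False by (intro weight_mono_closed) (auto simp: cap_def mirror_nth reflect_nth)
  then show ?thesis by (simp add: weight_even)
qed

text \<open>Writing \<open>y\<close> for the mirror image of \<open>x\<close>, the Laplacian of the gap is
  \<open>\<psi>(x) h(v(x)) - \<psi>(y) h(v(y))\<close>. Because \<open>h \<ge> 0\<close> and \<open>\<psi>(y) \<ge> \<psi>(x)\<close>, replacing \<open>\<psi>(y)\<close> by
  \<open>\<psi>(x)\<close> only increases it, and then the Lipschitz bound applies. The constant does not depend on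
  the hyperplane.\<close>

lemma gap_laplacian_bound:
  obtains C where "0 < C"
    "\<And>\<mu> x. \<mu> < 0 \<Longrightarrow> x \<in> cap \<mu> \<Longrightarrow> \<exists>D \<le> C * \<bar>gap \<mu> x\<bar>. has_laplacian (gap \<mu>) D x"
proof -
  have "compact (closure \<Omega>)" using bounded_domain by simp
  then have "bounded (\<psi> ` closure \<Omega>)"
    by (intro compact_imp_bounded compact_continuous_image continuous_on_subset[OF weight_continuous]) auto
  then obtain B where B: "0 < B" "\<And>x. x \<in> closure \<Omega> \<Longrightarrow> \<bar>\<psi> x\<bar> \<le> B"
    unfolding bounded_pos by auto
  have L: "0 \<le> L" using h_lipschitz by (rule lipschitz_on_nonneg)
  show ?thesis
    \<comment> \<open>the summand \<open>1\<close> only makes the constant positive\<close>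
  proof (rule that[of "B * L + 1"])
    show "0 < B * L + 1" using B L by (simp add: add_nonneg_pos)
    fix \<mu> x assume *: "\<mu> < 0" "x \<in> cap \<mu>"
    define y where "y = mirror \<mu> j x"
    have x: "x \<in> \<Omega>" and y: "y \<in> \<Omega>" using * mirror_mem by (auto simp: cap_def y_def)
    define D where "D = - (\<psi> y * h (v y)) - - (\<psi> x * h (v x))"
    have "has_laplacian (gap \<mu>) D x"
      unfolding gap_def[abs_def] D_def
      using has_laplacian_mirror[OF v_laplacian[OF y, unfolded y_def]] v_laplacian[OF x]
      by (intro has_laplacian_diff) (auto simp: y_def)
    moreover have "D \<le> (B * L + 1) * \<bar>gap \<mu> x\<bar>"
    proof -
      have "\<psi> x * h (v y) \<le> \<psi> y * h (v y)"
        using weight_mirror_ge[OF *] h_nonneg[OF y] by (simp add: y_def mult_right_mono)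
      then have "D \<le> \<psi> x * (h (v x) - h (v y))" by (simp add: D_def algebra_simps)
      also have "\<dots> \<le> \<psi> x * (L * \<bar>v y - v x\<bar>)"
      proof (rule mult_left_mono)
        have "\<bar>h (v x) - h (v y)\<bar> \<le> L * \<bar>v x - v y\<bar>"
          using lipschitz_onD[OF h_lipschitz] x y by (auto simp: dist_real_def)
        then show "h (v x) - h (v y) \<le> L * \<bar>v y - v x\<bar>" by (simp add: abs_minus_commute)
      qed (use weight_pos less_imp_le in blast)
      also have "\<dots> \<le> B * (L * \<bar>v y - v x\<bar>)"
        using B(2)[of x] x closure_subset[of \<Omega>] L by (intro mult_right_mono) auto
      also have "\<dots> \<le> (B * L + 1) * \<bar>gap \<mu> x\<bar>" by (simp add: gap_def y_def algebra_simps)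
      finally show ?thesis .
    qed
    ultimately show "\<exists>D \<le> (B * L + 1) * \<bar>gap \<mu> x\<bar>. has_laplacian (gap \<mu>) D x" by blast
  qed
qed

text \<open>Positivity at the centre spreads to the whole ball: the gap is at least some \<open>\<kappa> > 0\<close> on a small
  concentric ball of radius \<open>\<rho>\<close>, and on the remaining annulus it is compared with \<open>\<kappa>\<close> times a
  barrier. The parameter \<open>\<tau>\<close> is chosen so large that \<open>\<Delta>b > C b\<close> for the barrier \<open>b\<close> outside
  radius \<open>\<rho>\<close>, which is incompatible with \<open>\<Delta>w \<le> C w < C \<kappa> b\<close> at a negative minimum of
  \<open>w - \<kappa> b\<close>.\<close>

lemma gap_pos_on_ball:
  assumes "\<mu> < 0" "\<And>x. x \<in> cap \<mu> \<Longrightarrow> 0 \<le> gap \<mu> x"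
    and "ball y R \<subseteq> cap \<mu>" "0 < gap \<mu> y" "x \<in> ball y R"
  shows "0 < gap \<mu> x"
proof -
  obtain C where C: "0 < C"
    "\<And>x. x \<in> cap \<mu> \<Longrightarrow> \<exists>D \<le> C * \<bar>gap \<mu> x\<bar>. has_laplacian (gap \<mu>) D x"
    using gap_laplacian_bound assms(1) by metis
  obtain R' where R': "dist y x < R'" "R' < R" using assms(5) dense by auto
  have R'0: "0 < R'" using R'(1) zero_le_dist[of y x] by linarith
  have Q: "cball y R' \<subseteq> cap \<mu>" using R' assms(3) by auto
  have cont: "continuous_on (cap \<mu>) (gap \<mu>)"
    using continuous_on_gap[OF assms(1)] closure_subset continuous_on_subset by blast
  define \<kappa> where "\<kappa> = gap \<mu> y / 2"
  have "0 < \<kappa>" using assms(4) by (simp add: \<kappa>_def)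
  have "y \<in> cap \<mu>" using Q R'0 by auto
  then obtain \<rho> where \<rho>: "0 < \<rho>" "\<And>z. z \<in> cap \<mu> \<Longrightarrow> dist z y < \<rho> \<Longrightarrow> \<kappa> \<le> gap \<mu> z"
  proof -
    obtain d where "0 < d" "\<And>z. z \<in> cap \<mu> \<Longrightarrow> dist z y < d \<Longrightarrow> dist (gap \<mu> z) (gap \<mu> y) < \<kappa>"
      using cont \<open>y \<in> cap \<mu>\<close> \<open>0 < \<kappa>\<close> unfolding continuous_on_iff by metis
    moreover have "\<kappa> \<le> gap \<mu> z" if "dist (gap \<mu> z) (gap \<mu> y) < \<kappa>" for z
      using that unfolding dist_real_def \<kappa>_def by linarith
    ultimately show ?thesis by (intro that[of d]) auto
  qed
  define N where "N = real CARD('n)"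
  define \<tau> where "\<tau> = max 1 ((2 * N + C) / (4 * \<rho>\<^sup>2) + 1)"
  have \<tau>: "1 \<le> \<tau>" by (simp add: \<tau>_def)
  have steep: "C < 4 * \<tau>\<^sup>2 * r\<^sup>2 - 2 * N * \<tau>" if "\<rho> \<le> r" for r
  proof -
    have "(2 * N + C) / (4 * \<rho>\<^sup>2) < \<tau>" by (simp add: \<tau>_def)
    then have "2 * N + C < 4 * \<tau> * \<rho>\<^sup>2" using \<rho>(1) by (simp add: field_simps)
    also have "\<dots> \<le> 4 * \<tau> * r\<^sup>2" using that \<rho>(1) \<tau> by (simp add: power_mono)
    finally have "2 * N + C < 4 * \<tau> * r\<^sup>2" .
    then have "\<tau> * (2 * N + C) < \<tau> * (4 * \<tau> * r\<^sup>2)" using \<tau> by simp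
    moreover have "C \<le> \<tau> * C" using \<tau> C(1) by simp
    ultimately show ?thesis by (simp add: algebra_simps power2_eq_square)
  qed
  define F where "F z = gap \<mu> z - \<kappa> * barrier \<tau> y R' z" for z
  have "0 \<le> F x"
  proof (rule minimum_principle[where Q = "cball y R'" and f = F])
    show "compact (cball y R')" by simp
    show "continuous_on (cball y R') F" unfolding F_def
      by (intro continuous_intros continuous_on_barrier continuous_on_subset[OF cont Q])
    show "x \<in> cball y R'" using R' by auto
  next
    fix q assume q: "q \<in> cball y R'" "F q < 0"
    then have qc: "q \<in> cap \<mu>" using Q by blast
    define r where "r = norm (q - y)"
    have below: "gap \<mu> q < \<kappa> * barrier \<tau> y R' q" using q by (simp add: F_def)
    have gq: "0 \<le> gap \<mu> q" using assms(2) qc .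
    have "\<rho> \<le> r"
    proof (rule ccontr)
      assume "\<not> \<rho> \<le> r"
      then have "\<kappa> \<le> gap \<mu> q" using \<rho>(2) qc by (simp add: r_def dist_norm)
      moreover have "barrier \<tau> y R' q < 1" using barrier_less_1[of \<tau>] \<tau> by simp
      then have "\<kappa> * barrier \<tau> y R' q < \<kappa> * 1" using \<open>0 < \<kappa>\<close> by (intro mult_strict_left_mono)
      ultimately show False using below by simp
    qed
    have "r \<noteq> R'"
      using below gq by (auto simp: barrier_def r_def)
    then have "q \<in> ball y R'" using q by (auto simp: r_def dist_norm norm_minus_commute)
    then have int: "q \<in> interior (cball y R')" by simp
    obtain D where D: "D \<le> C * gap \<mu> q" "has_laplacian (gap \<mu>) D q"
      using C(2)[OF qc] gq by auto
    define E where "E = exp (- \<tau> * r\<^sup>2)"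
    have "has_laplacian F (D - \<kappa> * ((4 * \<tau>\<^sup>2 * r\<^sup>2 - 2 * N * \<tau>) * E)) q"
      unfolding F_def[abs_def] r_def E_def N_def
      by (intro has_laplacian_diff has_laplacian_cmult has_laplacian_barrier D(2))
    moreover have "D < \<kappa> * ((4 * \<tau>\<^sup>2 * r\<^sup>2 - 2 * N * \<tau>) * E)"
    proof -
      have "D \<le> C * (\<kappa> * barrier \<tau> y R' q)"
        using D(1) below C(1) by (meson less_imp_le mult_left_mono order_trans)
      also have "\<dots> \<le> \<kappa> * (C * E)"
        using C(1) \<open>0 < \<kappa>\<close> by (simp add: barrier_def E_def r_def)
      also have "\<dots> < \<kappa> * ((4 * \<tau>\<^sup>2 * r\<^sup>2 - 2 * N * \<tau>) * E)"
        using steep[OF \<open>\<rho> \<le> r\<close>] \<open>0 < \<kappa>\<close> by (simp add: E_def)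
      finally show ?thesis .
    qed
    ultimately show "q \<in> interior (cball y R') \<and> (\<exists>D<0. has_laplacian F D q)"
      using int by (meson diff_less_0_iff_less)
  qed
  moreover have "0 < barrier \<tau> y R' x"
    using R' \<tau> by (intro barrier_pos) (auto simp: dist_norm norm_minus_commute)
  ultimately show ?thesis using \<open>0 < \<kappa>\<close> by (smt (verit) F_def mult_pos_pos)
qed

lemma left_exit:
  assumes "x \<in> \<Omega>"
  obtains t where "0 < t" "x - t *\<^sub>R axis j 1 \<in> frontier \<Omega>"
    "\<And>s. 0 \<le> s \<Longrightarrow> s < t \<Longrightarrow> x - s *\<^sub>R axis j 1 \<in> \<Omega>"
proof -
  define l where "l s = x - s *\<^sub>R axis j (1::real)" for s
  have cont: "continuous_on S l" for S unfolding l_def by (intro continuous_intros)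
  define T where "T = {0..} \<inter> l -` (- \<Omega>)"
  have "closed (l -` (- \<Omega>))"
    using open_domain by (intro continuous_closed_vimage) (auto simp: l_def[abs_def] intro!: continuous_intros)
  then have "closed T" unfolding T_def by (intro closed_Int) auto
  obtain b where b: "\<And>y. y \<in> \<Omega> \<Longrightarrow> norm y \<le> b" using bounded_domain unfolding bounded_iff by blast
  have "T \<noteq> {}"
  proof -
    have b0: "0 \<le> b" using b[OF assms] norm_ge_zero order_trans by blast
    have "norm (l (b + norm x + 1)) \<ge> norm ((b + norm x + 1) *\<^sub>R axis j (1::real) :: real^'n) - norm x"
      unfolding l_def by (metis norm_minus_commute norm_triangle_ineq2)
    moreover have "norm ((b + norm x + 1) *\<^sub>R axis j (1::real) :: real^'n) = b + norm x + 1"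
      using b0 by (simp add: norm_axis_1 add_nonneg_nonneg)
    ultimately have "l (b + norm x + 1) \<notin> \<Omega>" using b by fastforce
    then have "b + norm x + 1 \<in> T" using b0 by (auto simp: T_def)
    then show ?thesis by blast
  qed
  have bdd: "bdd_below T" by (auto simp: T_def bdd_below_def)
  define t where "t = Inf T"
  have tT: "t \<in> T" unfolding t_def using \<open>closed T\<close> \<open>T \<noteq> {}\<close> bdd by (rule closed_contains_Inf[rotated 2])
  have inside: "l s \<in> \<Omega>" if "0 \<le> s" "s < t" for s
    using that cInf_lower[OF _ bdd, of s] by (auto simp: T_def t_def)
  have "t \<noteq> 0" using tT assms by (auto simp: T_def l_def)
  then have "0 < t" using tT by (auto simp: T_def)
  have "l t \<in> closure \<Omega>"
  proof -
    have "l ` closure {0..<t} \<subseteq> closure \<Omega>"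
      using inside closure_subset[of \<Omega>] by (intro image_closure_subset cont) auto
    then show ?thesis using \<open>0 < t\<close> by auto
  qed
  then have "l t \<in> frontier \<Omega>"
    using tT open_domain by (auto simp: T_def frontier_def interior_open)
  then show ?thesis using that[of t] \<open>0 < t\<close> inside by (auto simp: l_def)
qed

text \<open>The strong maximum principle. The cap may be disconnected, so the zero set of the gap has to be
  excluded from each component: by \<open>gap_pos_on_ball\<close> the positive part and the zero set are both
  open, so a zero spreads along the half-line to the left up to the boundary of \<open>\<Omega>\<close>. At the exit
  point \<open>v\<close> vanishes, but the mirror image of that point lies in \<open>\<Omega>\<close>, so the gap is positive.\<close>

lemma gap_pos:
  assumes "\<mu> < 0" "\<And>x. x \<in> cap \<mu> \<Longrightarrow> 0 \<le> gap \<mu> x" "x \<in> cap \<mu>"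
  shows "0 < gap \<mu> x"
proof (rule ccontr)
  assume "\<not> 0 < gap \<mu> x"
  define P where "P = {z \<in> cap \<mu>. 0 < gap \<mu> z}"
  define Z where "Z = {z \<in> cap \<mu>. gap \<mu> z = 0}"
  have "x \<in> Z" using assms(2,3) \<open>\<not> 0 < gap \<mu> x\<close> by (fastforce simp: Z_def)
  have "open P"
    unfolding open_contains_ball
  proof
    fix z assume z: "z \<in> P"
    then obtain d where "0 < d" "ball z d \<subseteq> cap \<mu>"
      using open_cap unfolding open_contains_ball P_def by blast
    then show "\<exists>d>0. ball z d \<subseteq> P"
      using gap_pos_on_ball[OF assms(1,2), of z d] z by (auto simp: P_def)
  qed
  have "open Z"
    unfolding open_contains_ball
  proof
    fix z assume z: "z \<in> Z"
    then obtain d where d: "0 < d" "ball z d \<subseteq> cap \<mu>"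
      using open_cap unfolding open_contains_ball Z_def by blast
    have "ball z (d / 2) \<subseteq> Z"
    proof
      fix y assume y: "y \<in> ball z (d / 2)"
      then have "ball y (d / 2) \<subseteq> cap \<mu>" using d dist_triangle_half_l[of y z d] subset_ball
        by (smt (verit) dist_commute dist_triangle_half_r in_mono mem_ball subsetI)
      moreover have "z \<in> ball y (d / 2)" using y by (simp add: dist_commute)
      ultimately have "\<not> 0 < gap \<mu> y"
        using gap_pos_on_ball[OF assms(1,2), of y "d / 2" z] z by (auto simp: Z_def)
      moreover have "y \<in> cap \<mu>" using y d by (auto simp: subset_iff)
      ultimately show "y \<in> Z" using assms(2) by (fastforce simp: Z_def)
    qed
    then show "\<exists>d>0. ball z d \<subseteq> Z" using d(1) half_gt_zero by blast
  qed
  obtain t where t: "0 < t" "x - t *\<^sub>R axis j 1 \<in> frontier \<Omega>"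
    "\<And>s. 0 \<le> s \<Longrightarrow> s < t \<Longrightarrow> x - s *\<^sub>R axis j 1 \<in> \<Omega>"
    using left_exit[of x] assms(3) by (auto simp: cap_def)
  define l where "l s = x - s *\<^sub>R axis j (1::real)" for s
  have cont: "continuous_on S l" for S unfolding l_def by (intro continuous_intros)
  have lj: "l s $ j = x $ j - s" for s by (simp add: l_def)
  have li: "i \<noteq> j \<Longrightarrow> l s $ i = x $ i" for s i by (simp add: l_def axis_def)
  have x: "x \<in> \<Omega>" "x $ j < \<mu>" using assms(3) by (auto simp: cap_def)
  define A where "A = l ` {0..<t}"
  have A: "A \<subseteq> cap \<mu>" using t(3) x(2) lj by (auto simp: A_def cap_def l_def)
  have "A \<subseteq> Z"
  proof (rule ccontr)
    assume "\<not> A \<subseteq> Z"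
    then have "P \<inter> A \<noteq> {}" using A assms(2) unfolding P_def Z_def by fastforce
    moreover have "x \<in> A" using t(1) by (auto simp: A_def l_def image_iff intro!: bexI[of _ 0])
    moreover have "A \<subseteq> P \<union> Z" using A assms(2) unfolding P_def Z_def by fastforce
    moreover have "connected A" unfolding A_def
      by (intro connected_continuous_image cont) auto
    moreover have "P \<inter> Z \<inter> A = {}" by (auto simp: P_def Z_def)
    ultimately show False
      using connectedD[of A P Z] \<open>open P\<close> \<open>open Z\<close> \<open>x \<in> Z\<close> by blast
  qed
  have "l t \<in> closure A"
  proof -
    have "l ` closure {0..<t} \<subseteq> closure A"
      unfolding A_def by (intro image_closure_subset cont closure_subset) simp
    then show ?thesis using t(1) by auto
  qed
  moreover have "continuous_on (closure A) (gap \<mu>)"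
    by (rule continuous_on_subset[OF continuous_on_gap[OF assms(1)] closure_mono[OF A]])
  ultimately have "gap \<mu> (l t) \<le> 0"
    using continuous_le_on_closure[of A "gap \<mu>" "l t" 0] \<open>A \<subseteq> Z\<close> by (force simp: Z_def)
  moreover have "mirror \<mu> j (l t) \<in> \<Omega>"
  proof -
    \<comment> \<open>a point of \<open>\<Omega>\<close> before the exit whose distance to the symmetry hyperplane is at least that of
      the mirror image of the exit point; it exists because \<open>\<mu> < 0\<close>\<close>
    define s where "s = max 0 (t + 2 * \<mu>)"
    have s: "0 \<le> s" "s < t" "t + 2 * \<mu> \<le> s" using t(1) assms(1) by (auto simp: s_def)
    show ?thesis
    proof (rule mem_of_smaller_height[of "l s"])
      show "l s \<in> \<Omega>" using t(3) s by (simp add: l_def)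
      show "\<bar>mirror \<mu> j (l t) $ j\<bar> \<le> \<bar>l s $ j\<bar>"
        using s x(2) assms(1) by (auto simp: mirror_nth lj)
    qed (auto simp: mirror_nth li)
  qed
  then have "0 < v (mirror \<mu> j (l t))" by (rule v_pos)
  moreover have "v (l t) = 0" using t(2) v_frontier by (simp add: l_def)
  ultimately show False by (simp add: gap_def)
qed

text \<open>Let \<open>- m\<close> be the negative minimum and \<open>b\<close> the barrier of radius \<open>R\<close> centred in a ball of radius
  \<open>c R\<close> that misses the cap. Then \<open>w + m - m b\<close> is nonnegative where \<open>w \<ge> 0\<close>, since \<open>b < 1\<close>, and on
  the sphere of radius \<open>R\<close>, where \<open>b = 0\<close>. Elsewhere \<open>\<Delta>w \<le> C m < m \<Delta>b\<close>, because \<open>\<Delta>b\<close> is of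
  order \<open>1/R\<^sup>2\<close> outside the small ball. So \<open>w \<ge> - m + m b > - m\<close> at every point within \<open>R\<close> of
  the centre, and none of them is the minimum point. The threshold \<open>R\<^sub>0\<close> does not depend on the
  hyperplane, which is what the limit argument needs.\<close>

lemma negative_minimum_not_near_complement:
  assumes "0 < c"
  obtains R\<^sub>0 where "0 < R\<^sub>0"
    "\<And>\<mu> R y x. \<mu> < 0 \<Longrightarrow> 0 < R \<Longrightarrow> R \<le> R\<^sub>0 \<Longrightarrow> ball y (c * R) \<inter> cap \<mu> = {} \<Longrightarrow>
       x \<in> closure (cap \<mu>) \<Longrightarrow> dist x y < R \<Longrightarrow>
       (\<And>z. z \<in> closure (cap \<mu>) \<Longrightarrow> gap \<mu> x \<le> gap \<mu> z) \<Longrightarrow> 0 \<le> gap \<mu> x"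
proof -
  obtain C where C: "0 < C"
    "\<And>\<mu> x. \<mu> < 0 \<Longrightarrow> x \<in> cap \<mu> \<Longrightarrow> \<exists>D \<le> C * \<bar>gap \<mu> x\<bar>. has_laplacian (gap \<mu>) D x"
    using gap_laplacian_bound by metis
  define N where "N = real CARD('n)"
  \<comment> \<open>with \<open>\<tau> = \<alpha> / R\<^sup>2\<close> the Laplacian of the barrier is at least \<open>2 \<tau> exp (- \<alpha>)\<close> at radii between
    \<open>c R\<close> and \<open>R\<close>, and \<open>R\<^sub>0\<close> is the radius at which this equals \<open>C + 1\<close>\<close>
  define \<alpha> where "\<alpha> = (N + 1) / (2 * c\<^sup>2)"
  have \<alpha>: "0 < \<alpha>" "2 * \<alpha> * c\<^sup>2 = N + 1" using assms by (auto simp: \<alpha>_def N_def add_nonneg_pos)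
  define R\<^sub>0 where "R\<^sub>0 = sqrt (2 * \<alpha> * exp (- \<alpha>) / (C + 1))"
  have R0: "0 < R\<^sub>0" "R\<^sub>0\<^sup>2 = 2 * \<alpha> * exp (- \<alpha>) / (C + 1)"
    using \<alpha> C(1) by (auto simp: R\<^sub>0_def)
  show ?thesis
  proof (rule that[OF R0(1)])
    fix \<mu> R :: real and y x :: "real^'n"
    assume "\<mu> < 0" and R: "0 < R" "R \<le> R\<^sub>0" and out: "ball y (c * R) \<inter> cap \<mu> = {}"
      and x: "x \<in> closure (cap \<mu>)" "dist x y < R"
      and min: "\<And>z. z \<in> closure (cap \<mu>) \<Longrightarrow> gap \<mu> x \<le> gap \<mu> z"
    show "0 \<le> gap \<mu> x"
    proof (rule ccontr)
      assume "\<not> 0 \<le> gap \<mu> x"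
      define m where "m = - gap \<mu> x"
      have m: "0 < m" using \<open>\<not> 0 \<le> gap \<mu> x\<close> by (simp add: m_def)
      define \<tau> where "\<tau> = \<alpha> / R\<^sup>2"
      have \<tau>: "0 < \<tau>" "\<tau> * R\<^sup>2 = \<alpha>" using \<alpha> R by (auto simp: \<tau>_def)
      define F where "F z = gap \<mu> z - m * (barrier \<tau> y R z - 1)" for z
      let ?Q = "closure (cap \<mu>) \<inter> cball y R"
      have steep: "C < (4 * \<tau>\<^sup>2 * r\<^sup>2 - 2 * N * \<tau>) * exp (- \<tau> * r\<^sup>2)" if r: "c * R \<le> r" "r \<le> R" for r
      proof -
        have "R\<^sup>2 \<le> R\<^sub>0\<^sup>2" using R by (simp add: power_mono)
        then have "C + 1 \<le> 2 * \<tau> * exp (- \<alpha>)"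
          using C(1) R unfolding R0(2) \<tau>_def by (simp add: field_simps)
        also have "\<dots> \<le> 2 * \<tau> * exp (- \<tau> * r\<^sup>2)"
        proof -
          have "r\<^sup>2 \<le> R\<^sup>2" using r R(1) assms by (intro power_mono) (auto intro: order_trans[rotated])
          then have "\<tau> * r\<^sup>2 \<le> \<alpha>" using \<tau> by (metis less_imp_le mult_left_mono)
          then show ?thesis using \<tau>(1) by simp
        qed
        also have "\<dots> \<le> (4 * \<tau>\<^sup>2 * r\<^sup>2 - 2 * N * \<tau>) * exp (- \<tau> * r\<^sup>2)"
        proof (rule mult_right_mono)
          have "(c * R)\<^sup>2 \<le> r\<^sup>2" using r assms R by (intro power_mono) auto
          then have "2 * \<tau> * (c * R)\<^sup>2 \<le> 2 * \<tau> * r\<^sup>2" using \<tau>(1) by simp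
          moreover have "2 * \<tau> * (c * R)\<^sup>2 = N + 1"
            using \<tau>(2) \<alpha>(2) by (metis (no_types, opaque_lifting) mult.assoc mult.commute power_mult_distrib)
          ultimately have "2 * \<tau> * (N + 1) \<le> 2 * \<tau> * (2 * \<tau> * r\<^sup>2)" using \<tau>(1) by simp
          then show "2 * \<tau> \<le> 4 * \<tau>\<^sup>2 * r\<^sup>2 - 2 * N * \<tau>" by (simp add: algebra_simps power2_eq_square)
        qed simp
        finally show ?thesis by simp
      qed
      have "0 \<le> F x"
      proof (rule minimum_principle[where Q = ?Q and f = F])
        show "compact ?Q" using compact_closure_cap by (intro compact_Int_closed) auto
        show "continuous_on ?Q F" unfolding F_def
          by (intro continuous_intros continuous_on_barrier
              continuous_on_subset[OF continuous_on_gap[OF \<open>\<mu> < 0\<close>]]) auto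
        show "x \<in> ?Q" using x by (auto simp: dist_commute)
      next
        fix q assume q: "q \<in> ?Q" "F q < 0"
        define r where "r = norm (q - y)"
        have below: "gap \<mu> q < m * (barrier \<tau> y R q - 1)" using q by (simp add: F_def)
        have ge: "- m \<le> gap \<mu> q" using min q by (auto simp: m_def)
        have "barrier \<tau> y R q < 1" using barrier_less_1 \<tau> by blast
        then have "m * (barrier \<tau> y R q - 1) < 0" using m by (simp add: mult_pos_neg)
        then have neg: "gap \<mu> q < 0" using below by simp
        then have qc: "q \<in> cap \<mu>" using gap_nonneg_outside_cap[OF \<open>\<mu> < 0\<close>, of q] q by force
        have "r \<noteq> R" using below ge by (auto simp: barrier_def r_def)
        then have ball: "q \<in> ball y R" "r \<le> R" using q by (auto simp: r_def dist_norm norm_minus_commute)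
        have "cap \<mu> \<inter> ball y R \<subseteq> ?Q" using closure_subset by auto
        then have int: "q \<in> interior ?Q"
          using ball qc open_cap by (meson IntI interior_maximal open_Int open_ball subsetD)
        have "c * R \<le> r" using out qc by (force simp: r_def dist_norm norm_minus_commute)
        obtain D where D: "D \<le> C * \<bar>gap \<mu> q\<bar>" "has_laplacian (gap \<mu>) D q"
          using C(2)[OF \<open>\<mu> < 0\<close> qc] by auto
        have "has_laplacian F (D - m * ((4 * \<tau>\<^sup>2 * r\<^sup>2 - 2 * N * \<tau>) * exp (- \<tau> * r\<^sup>2) - 0)) q"
          unfolding F_def[abs_def] r_def N_def
          by (intro has_laplacian_diff has_laplacian_cmult has_laplacian_barrier
              has_laplacian_const D(2))
        moreover have "D < m * ((4 * \<tau>\<^sup>2 * r\<^sup>2 - 2 * N * \<tau>) * exp (- \<tau> * r\<^sup>2) - 0)"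
        proof -
          have "D \<le> C * m" using D(1) ge neg C(1)
            by (smt (verit) mult_left_mono)
          also have "\<dots> = m * C" by simp
          also have "\<dots> < m * ((4 * \<tau>\<^sup>2 * r\<^sup>2 - 2 * N * \<tau>) * exp (- \<tau> * r\<^sup>2) - 0)"
            using steep[OF \<open>c * R \<le> r\<close> ball(2)] m by simp
          finally show ?thesis .
        qed
        ultimately show "q \<in> interior ?Q \<and> (\<exists>D<0. has_laplacian F D q)"
          using int by (meson diff_less_0_iff_less)
      qed
      moreover have "0 < barrier \<tau> y R x"
        using x \<tau> by (intro barrier_pos) (auto simp: dist_norm)
      ultimately show False using m by (simp add: F_def m_def mult_less_0_iff algebra_simps zero_le_mult_iff)
    qed
  qed
qed

lemma continuous_gap_plane:
  assumes "x \<in> \<Omega>" "mirror \<mu> j x \<in> \<Omega>"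
  shows "((\<lambda>s. gap s x) \<longlongrightarrow> gap \<mu> x) (at \<mu>)"
proof -
  have "isCont v (mirror \<mu> j x)"
    using v_continuous assms(2) open_domain
    by (meson closure_subset continuous_on_eq_continuous_at continuous_on_subset)
  moreover have "isCont (\<lambda>s. mirror s j x) \<mu>" by (intro continuous_mirror) auto
  ultimately have "isCont (\<lambda>s. v (mirror s j x)) \<mu>" using isCont_o2 by blast
  then show ?thesis unfolding gap_def by (intro tendsto_intros) (simp add: isCont_def)
qed

text \<open>The set \<open>B\<close> of bad hyperplanes is bounded below because far to the left the cap is empty; this
  starts the procedure. The infimum \<open>\<nu>\<close> of \<open>B\<close> is itself good, and the minimum points
  belonging to bad hyperplanes close to it accumulate at a point that is neither inside the cap nor
  on its boundary.\<close>

theorem gap_nonneg: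
  assumes "\<mu> < 0" "x \<in> cap \<mu>"
  shows "0 \<le> gap \<mu> x"
proof (rule ccontr)
  assume "\<not> 0 \<le> gap \<mu> x"
  define B where "B = {s. s < 0 \<and> (\<exists>x\<in>cap s. gap s x < 0)}"
  have "\<mu> \<in> B" unfolding B_def using assms \<open>\<not> 0 \<le> gap \<mu> x\<close> by (intro CollectI conjI bexI[of _ x]) auto
  obtain b where b: "\<And>y. y \<in> \<Omega> \<Longrightarrow> norm y \<le> b" using bounded_domain unfolding bounded_iff by blast
  have bdd: "bdd_below B"
  proof (rule bdd_belowI)
    fix s assume "s \<in> B"
    then obtain x where "x \<in> \<Omega>" "x $ j < s" by (auto simp: B_def cap_def)
    then show "- b \<le> s" using b[of x] component_le_norm_cart[of x j] by linarith
  qed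
  define \<nu> where "\<nu> = Inf B"
  have "\<nu> \<le> \<mu>" unfolding \<nu>_def using \<open>\<mu> \<in> B\<close> bdd by (rule cInf_lower)
  then have "\<nu> < 0" using assms(1) by simp
  have nonneg: "0 \<le> gap \<nu> x" if x: "x \<in> cap \<nu>" for x
  proof (rule ccontr)
    assume neg: "\<not> 0 \<le> gap \<nu> x"
    have x': "x \<in> \<Omega>" "x $ j < \<nu>" using x by (auto simp: cap_def)
    have lim: "((\<lambda>s. gap s x) \<longlongrightarrow> gap \<nu> x) (at_left \<nu>)"
      using continuous_gap_plane[OF x'(1) mirror_mem[OF \<open>\<nu> < 0\<close> x]]
      by (rule tendsto_mono[rotated]) (simp add: at_le)
    have "\<forall>\<^sub>F s in at_left \<nu>. gap s x < 0" using neg by (intro order_tendstoD(2)[OF lim]) auto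
    moreover have "\<forall>\<^sub>F s in at_left \<nu>. s \<in> {x $ j<..<\<nu>}"
      using x'(2) by (rule eventually_at_left_real)
    ultimately have "\<forall>\<^sub>F s in at_left \<nu>. s \<in> B \<and> s < \<nu>"
      by eventually_elim (use x' \<open>\<nu> < 0\<close> in \<open>auto simp: B_def cap_def\<close>)
    then obtain s where "s \<in> B" "s < \<nu>" using eventually_happens trivial_limit_at_left_real by blast
    then show False using cInf_lower[OF _ bdd] \<nu>_def by fastforce
  qed
  define bad where "bad n s x \<longleftrightarrow> \<nu> \<le> s \<and> s < \<nu> + 1 / real (Suc n) \<and> s < 0 \<and>
      x \<in> closure (cap s) \<and> gap s x < 0 \<and> (\<forall>z\<in>closure (cap s). gap s x \<le> gap s z)" for n s x
  have "\<exists>s x. bad n s x" for n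
  proof -
    have "Inf B < \<nu> + 1 / real (Suc n)" by (simp add: \<nu>_def)
    then obtain s where s: "s \<in> B" "s < \<nu> + 1 / real (Suc n)"
      using cInf_lessD \<open>\<mu> \<in> B\<close> by blast
    then obtain y where y: "y \<in> cap s" "gap s y < 0" "s < 0" by (auto simp: B_def)
    then have yc: "y \<in> closure (cap s)" using closure_subset by blast
    have ne: "closure (cap s) \<noteq> {}" using yc by (rule ex_in_conv[THEN iffD1, OF exI])
    obtain x where x: "x \<in> closure (cap s)" "\<forall>z\<in>closure (cap s). gap s x \<le> gap s z"
      by (rule bexE[OF continuous_attains_inf[OF compact_closure_cap ne continuous_on_gap[OF y(3)]]])
    have "\<nu> \<le> s" using cInf_lower[OF s(1) bdd] by (simp add: \<nu>_def)
    moreover have "gap s x < 0" using x(2) yc y(2) by fastforce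
    ultimately have "bad n s x" using s(2) y(3) x by (simp add: bad_def)
    then show ?thesis by blast
  qed
  then obtain s X where "\<And>n. bad n (s n) (X n)" by metis
  then have sX: "\<And>n. \<nu> \<le> s n" "\<And>n. s n < \<nu> + 1 / real (Suc n)" "\<And>n. s n < 0"
      "\<And>n. X n \<in> closure (cap (s n))" "\<And>n. gap (s n) (X n) < 0"
      "\<And>n z. z \<in> closure (cap (s n)) \<Longrightarrow> gap (s n) (X n) \<le> gap (s n) z"
    by (simp_all add: bad_def)
  have "s \<longlonglongrightarrow> \<nu>"
  proof (rule tendsto_sandwich[of "\<lambda>_. \<nu>" s _ "\<lambda>n. \<nu> + 1 / real (Suc n)"])
    show "(\<lambda>n. \<nu> + 1 / real (Suc n)) \<longlonglongrightarrow> \<nu>"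
      using tendsto_add[OF tendsto_const LIMSEQ_Suc[OF lim_1_over_n]] by fastforce
  qed (use sX(1) less_imp_le[OF sX(2)] in \<open>simp_all\<close>)
  have "compact (closure \<Omega>)" using bounded_domain by simp
  moreover have Xcl: "X n \<in> closure \<Omega>" for n using sX(4) closure_cap by blast
  ultimately obtain x r where x: "x \<in> closure \<Omega>" and r: "strict_mono r" and "(X \<circ> r) \<longlonglongrightarrow> x"
    unfolding compact_def by blast
  define s' X' where "s' n = s (r n)" and "X' n = X (r n)" for n
  have lims: "s' \<longlonglongrightarrow> \<nu>" "X' \<longlonglongrightarrow> x"
    using LIMSEQ_subseq_LIMSEQ[OF \<open>s \<longlonglongrightarrow> \<nu>\<close> r] \<open>(X \<circ> r) \<longlonglongrightarrow> x\<close>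
    by (auto simp: s'_def[abs_def] X'_def[abs_def] o_def)
  \<comment> \<open>no limit point of the minimum points can have exterior balls of all small scales next to it\<close>
  have contra: False
    if c: "0 < c" "0 < \<delta>" and near: "\<And>R. 0 < R \<Longrightarrow> R < \<delta> \<Longrightarrow>
      \<exists>y. dist x y \<le> R / 2 \<and> (\<forall>\<^sub>F n in sequentially. ball y (c * R) \<inter> cap (s' n) = {})" for c \<delta>
  proof -
    obtain R\<^sub>0 where R0: "0 < R\<^sub>0"
      "\<And>\<mu> R y x. \<mu> < 0 \<Longrightarrow> 0 < R \<Longrightarrow> R \<le> R\<^sub>0 \<Longrightarrow> ball y (c * R) \<inter> cap \<mu> = {} \<Longrightarrow>
         x \<in> closure (cap \<mu>) \<Longrightarrow> dist x y < R \<Longrightarrow>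
         (\<And>z. z \<in> closure (cap \<mu>) \<Longrightarrow> gap \<mu> x \<le> gap \<mu> z) \<Longrightarrow> 0 \<le> gap \<mu> x"
      using negative_minimum_not_near_complement[OF \<open>0 < c\<close>] by metis
    define R where "R = min R\<^sub>0 \<delta> / 2"
    have R: "0 < R" "R \<le> R\<^sub>0" "R < \<delta>" using R0(1) c(2) by (auto simp: R_def)
    obtain y where y: "dist x y \<le> R / 2" "\<forall>\<^sub>F n in sequentially. ball y (c * R) \<inter> cap (s' n) = {}"
      using near[OF R(1,3)] by blast
    have "\<forall>\<^sub>F n in sequentially. dist (X' n) x < R / 2"
      using tendstoD[OF lims(2), of "R / 2"] R(1) by simp
    with y(2) obtain n where n: "ball y (c * R) \<inter> cap (s' n) = {}" "dist (X' n) x < R / 2"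
      using eventually_happens'[OF sequentially_bot eventually_conj] by meson
    have "dist (X' n) y < R" using n(2) y(1) dist_triangle[of "X' n" y x] by linarith
    then have "0 \<le> gap (s' n) (X' n)"
      using sX(3-6) n(1) R(1,2) unfolding s'_def X'_def by (intro R0(2)[of _ R y]) auto
    then show False using sX(5)[of "r n"] by (simp add: s'_def X'_def)
  qed
  have "x $ j \<le> \<nu>"
  proof (rule LIMSEQ_le[OF _ lims(1)])
    show "(\<lambda>n. X' n $ j) \<longlonglongrightarrow> x $ j" using lims(2) by (rule tendsto_vec_nth)
    show "\<exists>N. \<forall>n\<ge>N. X' n $ j \<le> s' n" using sX(4) closure_cap by (fastforce simp: X'_def s'_def)
  qed
  consider "x \<in> cap \<nu>" | "x $ j = \<nu>" | "x \<in> frontier \<Omega>"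
    using x \<open>x $ j \<le> \<nu>\<close> open_domain by (force simp: cap_def frontier_def interior_open)
  then show False
  proof cases
    case 1
    have "isCont (\<lambda>z. mirror (fst z) j (snd z)) (\<nu>, x)" by (intro continuous_mirror) auto
    then have "(\<lambda>n. mirror (s' n) j (X' n)) \<longlonglongrightarrow> mirror \<nu> j x"
      using isCont_tendsto_compose[OF _ tendsto_Pair[OF lims]] by fastforce
    moreover have "mirror (s' n) j (X' n) \<in> closure \<Omega>" for n
      using mirror_mem_closure sX(3,4) by (simp add: s'_def X'_def)
    moreover have "mirror \<nu> j x \<in> closure \<Omega>"
      using mirror_mem[OF \<open>\<nu> < 0\<close> 1] closure_subset by blast
    moreover have "X' n \<in> closure \<Omega>" for n using Xcl by (simp add: X'_def)
    ultimately have "(\<lambda>n. gap (s' n) (X' n)) \<longlonglongrightarrow> gap \<nu> x"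
      unfolding gap_def using x lims(2)
      by (intro tendsto_diff continuous_on_tendsto_compose[OF v_continuous]) auto
    then have "gap \<nu> x \<le> 0"
      using sX(5) by (intro LIMSEQ_le_const2[of _ "gap \<nu> x"]) (auto simp: s'_def X'_def less_imp_le)
    then show False using gap_pos[OF \<open>\<nu> < 0\<close> nonneg 1] by simp
  next
    case 2
    show False
    proof (rule contra[of "1 / 4" 1])
      fix R :: real assume R: "0 < R"
      define y where "y = x + (R / 2) *\<^sub>R axis j 1"
      have "dist x y \<le> R / 2" using R by (simp add: y_def dist_norm norm_axis_1)
      moreover have "\<forall>\<^sub>F n in sequentially. s' n < \<nu> + R / 4"
        using lims(1) R by (intro order_tendstoD(2)) auto
      then have "\<forall>\<^sub>F n in sequentially. ball y (1 / 4 * R) \<inter> cap (s' n) = {}"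
      proof eventually_elim
        case (elim n)
        have "s' n < z $ j" if "dist y z < R / 4" for z
        proof -
          have "y $ j - z $ j < R / 4"
            using that component_le_norm_cart[of "y - z" j] by (simp add: dist_norm)
          then show ?thesis using elim 2 by (simp add: y_def)
        qed
        then show ?case by (fastforce simp: cap_def)
      qed
      ultimately show "\<exists>y. dist x y \<le> R / 2 \<and>
          (\<forall>\<^sub>F n in sequentially. ball y (1 / 4 * R) \<inter> cap (s' n) = {})" by blast
    qed auto
  next
    case 3
    then obtain c \<rho> where c: "0 < c" "0 < \<rho>"
      "\<And>t. 0 < t \<Longrightarrow> t < \<rho> \<Longrightarrow> \<exists>y. dist x y \<le> t \<and> ball y (c * t) \<inter> \<Omega> = {}"
      using corkscrew by metis
    show False
    proof (rule contra[of "c / 2" \<rho>])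
      fix R assume "0 < R" "R < \<rho>"
      then obtain y where y: "dist x y \<le> R / 2" "ball y (c * (R / 2)) \<inter> \<Omega> = {}"
        using c(3)[of "R / 2"] by auto
      then have "ball y (c / 2 * R) \<inter> cap \<mu> = {}" for \<mu> by (auto simp: cap_def)
      then show "\<exists>y. dist x y \<le> R / 2 \<and>
          (\<forall>\<^sub>F n in sequentially. ball y (c / 2 * R) \<inter> cap (s' n) = {})"
        using y(1) by (intro exI[of _ y]) simp
    qed (use c in auto)
  qed
qed

theorem reflect_ge:
  assumes "x \<in> \<Omega>" "x $ j < 0"
  shows "v x \<le> v (reflect j x)"
proof -
  have "reflect j x \<in> \<Omega>" using symmetric assms(1) by blast
  then have lim: "((\<lambda>s. gap s x) \<longlongrightarrow> gap 0 x) (at_left 0)"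
    by (intro tendsto_mono[OF _ continuous_gap_plane[OF assms(1)]]) (auto simp: at_le mirror_0)
  have "\<forall>\<^sub>F s in at_left 0. s \<in> {x $ j<..<0}" using assms(2) by (rule eventually_at_left_real)
  then have "\<forall>\<^sub>F s in at_left 0. 0 \<le> gap s x"
    by eventually_elim (use assms gap_nonneg in \<open>auto simp: cap_def\<close>)
  then have "0 \<le> gap 0 x" by (intro tendsto_lowerbound[OF lim]) auto
  then show ?thesis by (simp add: gap_def mirror_0)
qed

end

lemma moving_planes_reflect:
  assumes "moving_planes \<Omega> j \<psi> v h L"
  shows "moving_planes \<Omega> j \<psi> (\<lambda>x. v (reflect j x)) h L"
proof -
  interpret moving_planes \<Omega> j \<psi> v h L by (rule assms)
  have mem: "reflect j x \<in> \<Omega>" if "x \<in> \<Omega>" for x using that symmetric by blast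
  have cont: "continuous_on S (reflect j)" for S using continuous_on_mirror[of S 0 j] by (simp add: mirror_0)
  have cl: "reflect j x \<in> closure \<Omega>" if "x \<in> closure \<Omega>" for x
  proof -
    have "reflect j ` closure \<Omega> \<subseteq> closure \<Omega>"
      using mem closure_subset by (intro image_closure_subset cont) auto
    then show ?thesis using that by blast
  qed
  have fr: "reflect j x \<in> frontier \<Omega>" if "x \<in> frontier \<Omega>" for x
    using that cl mem[of "reflect j x"] open_domain
    by (auto simp: frontier_def interior_open reflect_reflect)
  have img: "(\<lambda>x. v (reflect j x)) ` \<Omega> = v ` \<Omega>" by (metis image_image symmetric)
  show ?thesis
  proof (unfold_locales)
    show "continuous_on (closure \<Omega>) (\<lambda>x. v (reflect j x))"
      by (rule continuous_on_compose2[OF v_continuous cont]) (use cl in auto)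
    show "has_laplacian (\<lambda>x. v (reflect j x)) (- (\<psi> x * h (v (reflect j x)))) x" if "x \<in> \<Omega>" for x
      using has_laplacian_mirror[of v _ 0 j x] v_laplacian[OF mem[OF that]]
      by (simp add: mirror_0 weight_even)
    show "L-lipschitz_on ((\<lambda>x. v (reflect j x)) ` \<Omega>) h" using h_lipschitz by (simp add: img)
  qed (use open_domain bounded_domain symmetric convex_direction corkscrew weight_continuous
      weight_pos weight_even weight_increasing v_pos mem fr v_frontier h_nonneg in auto)
qed

theorem (in moving_planes) reflection_symmetry:
  assumes "x \<in> \<Omega>"
  shows "v (reflect j x) = v x"
proof -
  interpret r: moving_planes \<Omega> j \<psi> "\<lambda>x. v (reflect j x)" h L
    by (rule moving_planes_reflect) (rule moving_planes_axioms)
  have eq: "v (reflect j y) = v y" if "y \<in> \<Omega>" "y $ j < 0" for y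
    using reflect_ge[OF that] r.reflect_ge[OF that] by (simp add: reflect_reflect)
  consider "x $ j < 0" | "x $ j = 0" | "0 < x $ j" by linarith
  then show ?thesis
  proof cases
    case 1
    then show ?thesis using eq assms by blast
  next
    case 2
    then have "reflect j x = x" by (simp add: vec_eq_iff reflect_nth)
    then show ?thesis by simp
  next
    case 3
    have "reflect j x \<in> \<Omega>" using symmetric assms by blast
    then show ?thesis using eq[of "reflect j x"] 3 by (simp add: reflect_reflect reflect_nth)
  qed
qed


section \<open>Exterior balls for smooth boundaries\<close>

lemma partial_deriv_bound_lipschitz:
  fixes g :: "real^'n::finite \<Rightarrow> real"
  assumes "convex S" "x \<in> S" "y \<in> S"
    and "\<And>z. z \<in> S \<Longrightarrow> g differentiable (at z)"
    and "\<And>z i. z \<in> S \<Longrightarrow> \<bar>partial_deriv i g z\<bar> \<le> b"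
  shows "\<bar>g x - g y\<bar> \<le> real CARD('n) * b * norm (x - y)"
proof -
  have der: "(g has_derivative frechet_derivative g (at z)) (at z within S)" if "z \<in> S" for z
    using assms(4)[OF that] frechet_derivative_works has_derivative_at_withinI by blast
  have bound: "onorm (frechet_derivative g (at z)) \<le> real CARD('n) * b" if z: "z \<in> S" for z
  proof (rule onorm_le)
    fix h :: "real^'n"
    have lin: "linear (frechet_derivative g (at z))"
      using assms(4)[OF z] linear_frechet_derivative by blast
    have "frechet_derivative g (at z) h = frechet_derivative g (at z) (\<Sum>i\<in>UNIV. h $ i *\<^sub>R axis i 1)"
      using basis_expansion[of h] by (simp add: scalar_mult_eq_scaleR)
    also have "\<dots> = (\<Sum>i\<in>UNIV. h $ i * partial_deriv i g z)"
      by (simp add: linear_sum[OF lin] linear_scale[OF lin] partial_deriv_def)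
    also have "norm \<dots> \<le> (\<Sum>i\<in>(UNIV::'n set). norm h * b)"
    proof (rule sum_norm_le)
      fix i
      show "norm (h $ i * partial_deriv i g z) \<le> norm h * b"
        using assms(5)[OF z, of i] component_le_norm_cart[of h i]
        by (simp add: abs_mult mult_mono')
    qed
    finally show "norm (frechet_derivative g (at z) h) \<le> real CARD('n) * b * norm h"
      by (simp add: mult_ac)
  qed
  have "norm (g x - g y) \<le> real CARD('n) * b * norm (x - y)"
    by (rule differentiable_bound[OF assms(1) der bound assms(2,3)])
  then show ?thesis by simp
qed

lemma C1_locally_lipschitz:
  fixes g :: "real^'n::finite \<Rightarrow> real"
  assumes "C_on 1 UNIV g"
  obtains K where "0 \<le> K" "\<And>x y. x \<in> ball z r \<Longrightarrow> y \<in> ball z r \<Longrightarrow> \<bar>g x - g y\<bar> \<le> K * norm (x - y)"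
proof -
  have diff: "g differentiable (at x)" and cont: "continuous_on UNIV (partial_deriv i g)" for x i
    using assms by auto
  have "\<exists>b. \<forall>x\<in>cball z r. \<bar>partial_deriv i g x\<bar> \<le> b" for i
  proof -
    have "bounded (partial_deriv i g ` cball z r)"
      by (intro compact_imp_bounded compact_continuous_image continuous_on_subset[OF cont]) auto
    then show ?thesis unfolding bounded_iff by auto
  qed
  then obtain b where b: "\<And>i x. x \<in> cball z r \<Longrightarrow> \<bar>partial_deriv i g x\<bar> \<le> b i" by metis
  define B where "B = (\<Sum>i\<in>UNIV. \<bar>b i\<bar>)"
  have "\<bar>partial_deriv i g x\<bar> \<le> B" if "x \<in> ball z r" for i x
  proof -
    have "\<bar>b i\<bar> \<le> B" unfolding B_def by (rule member_le_sum) auto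
    moreover have "\<bar>partial_deriv i g x\<bar> \<le> b i" using b that by auto
    ultimately show ?thesis by linarith
  qed
  then have "\<bar>g x - g y\<bar> \<le> real CARD('n) * B * norm (x - y)" if "x \<in> ball z r" "y \<in> ball z r" for x y
    using that diff by (intro partial_deriv_bound_lipschitz[of "ball z r"]) auto
  moreover have "0 \<le> real CARD('n) * B" by (simp add: B_def sum_nonneg)
  ultimately show ?thesis by (intro that[of "real CARD('n) * B"])
qed

text \<open>Move from the boundary point a small distance \<open>t\<close> out of the domain along the graph direction. If \<open>K\<close> is
  a Lipschitz constant of the graph function, a ball of radius \<open>t / (1 + K)\<close> about the new
  point stays on the outer side of the graph.\<close>

lemma smooth_boundary_corkscrew:
  fixes \<Omega> :: "(real^'n::finite) set"
  assumes "open \<Omega>" "smooth_boundary \<Omega>" "z \<in> frontier \<Omega>"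
  shows "\<exists>c>0. \<exists>r>0. \<forall>t. 0 < t \<longrightarrow> t < r \<longrightarrow> (\<exists>y. dist z y \<le> t \<and> ball y (c * t) \<inter> \<Omega> = {})"
proof -
  obtain r j \<sigma> g where r: "0 < r" and "\<sigma> \<in> {-1, 1::real}" and g: "smooth_on UNIV g"
    and ind: "\<forall>x y. (\<forall>i. i \<noteq> j \<longrightarrow> x $ i = y $ i) \<longrightarrow> g x = g y"
    and graph: "\<Omega> \<inter> ball z r = {x \<in> ball z r. \<sigma> * x $ j > g x}"
    by (rule bspec[OF assms(2)[unfolded smooth_boundary_def] assms(3), THEN exE])
       (elim exE conjE bexE, rule that; assumption)
  then have \<sigma>: "\<sigma> = - 1 \<or> \<sigma> = 1" by simp
  have "C_on 1 UNIV g" using g unfolding smooth_on_def by blast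
  then obtain K where K: "0 \<le> K"
    "\<And>x y. x \<in> ball z r \<Longrightarrow> y \<in> ball z r \<Longrightarrow> \<bar>g x - g y\<bar> \<le> K * norm (x - y)"
    using C1_locally_lipschitz[of g z r] by metis
  have "z \<notin> \<Omega>" using assms(1,3) by (simp add: frontier_def interior_open)
  then have gz: "\<sigma> * z $ j \<le> g z" using graph r by (fastforce simp: set_eq_iff)
  define c where "c = 1 / (1 + K)"
  have c: "0 < c" "c \<le> 1" "c * (1 + K) = 1" using K(1) by (auto simp: c_def)
  have "\<exists>y. dist z y \<le> t \<and> ball y (c * t) \<inter> \<Omega> = {}" if t: "0 < t" "t < r / 2" for t
  proof -
    define e where "e = (\<sigma> * t) *\<^sub>R axis j (1::real)"
    have e: "norm e = t" using \<sigma> t by (auto simp: e_def norm_axis_1)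
    have "ball (z - e) (c * t) \<inter> \<Omega> = {}"
    proof (rule ccontr)
      assume "ball (z - e) (c * t) \<inter> \<Omega> \<noteq> {}"
      then obtain x where x: "x \<in> \<Omega>" "dist (z - e) x < c * t" by auto
      define d where "d = x - (z - e)"
      have d: "norm d < c * t" using x(2) by (simp add: d_def dist_norm norm_minus_commute)
      have ct: "c * t \<le> t" using c(2) t(1) by simp
      have "norm (x - z) \<le> norm d + norm e"
        using norm_triangle_ineq4[of d e] by (simp add: d_def)
      then have "norm (x - z) < r" "norm d < r" using d e ct t by linarith+
      then have "x \<in> ball z r" by (simp add: dist_norm norm_minus_commute)
      then have "g x < \<sigma> * x $ j" using graph x(1) by blast
      also have "\<sigma> * x $ j = \<sigma> * z $ j - t + \<sigma> * d $ j"
        using \<sigma> by (auto simp: d_def e_def)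
      also have "\<sigma> * d $ j \<le> norm d"
        using \<sigma> component_le_norm_cart[of d j] by auto
      finally have "g x < g z - t + c * t" using gz d by linarith
      moreover have "g x = g (z + d)"
        by (rule ind[rule_format]) (auto simp: d_def e_def axis_def)
      moreover have "\<bar>g (z + d) - g z\<bar> \<le> K * norm (z + d - z)"
        using \<open>norm d < r\<close> r by (intro K(2)) (auto simp: dist_norm)
      moreover have "K * norm d \<le> K * (c * t)" using K(1) d by (intro mult_left_mono) auto
      ultimately have "t < c * t + K * (c * t)" by simp
      also have "\<dots> = c * (1 + K) * t" by (simp add: algebra_simps)
      finally show False using c(3) by simp
    qed
    then show "\<exists>y. dist z y \<le> t \<and> ball y (c * t) \<inter> \<Omega> = {}"
      using e by (intro exI[of _ "z - e"]) (simp add: dist_norm)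
  qed
  then show ?thesis using c(1) half_gt_zero[OF r] by blast
qed

section \<open>Removing the gradient term\<close>

lemma differentiable_axis_derivative:
  fixes f :: "real^'n::finite \<Rightarrow> real"
  assumes "f differentiable (at (x + t *\<^sub>R axis i 1))"
  shows "((\<lambda>t. f (x + t *\<^sub>R axis i 1)) has_real_derivative partial_deriv i f (x + t *\<^sub>R axis i 1)) (at t)"
proof -
  let ?l = "\<lambda>t. x + t *\<^sub>R axis i (1::real)"
  let ?D = "frechet_derivative f (at (?l t))"
  have f: "(f has_derivative ?D) (at (?l t))"
    using assms frechet_derivative_works by blast
  have "(?l has_derivative (\<lambda>s. s *\<^sub>R axis i 1)) (at t)"
    by (auto intro!: derivative_eq_intros)
  from has_derivative_compose[OF this f]
  have "((\<lambda>t. f (?l t)) has_derivative (\<lambda>s. ?D (s *\<^sub>R axis i 1))) (at t)" .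
  moreover have "(\<lambda>s. ?D (s *\<^sub>R axis i 1)) = (*) (?D (axis i 1))"
    using linear_scale[OF linear_frechet_derivative[OF assms]] by (auto simp: fun_eq_iff)
  ultimately show ?thesis by (simp add: has_field_derivative_def partial_deriv_def)
qed

lemma partial_deriv_eqI:
  fixes f :: "real^'n::finite \<Rightarrow> real"
  assumes "f differentiable (at x)"
    and "((\<lambda>t. f (x + t *\<^sub>R axis i 1)) has_real_derivative D) (at 0)"
  shows "partial_deriv i f x = D"
  using differentiable_axis_derivative[of f x 0 i] assms DERIV_unique by fastforce

lemma C2_second_deriv:
  fixes u :: "real^'n::finite \<Rightarrow> real"
  assumes "open \<Omega>" "C_on 2 \<Omega> u" "x \<in> \<Omega>"
  shows "has_second_deriv (\<lambda>t. u (x + t *\<^sub>R axis i 1)) (partial_deriv i (partial_deriv i u) x) 0"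
proof -
  have u: "u differentiable (at y)" "partial_deriv i u differentiable (at y)" if "y \<in> \<Omega>" for y
    using assms(2) that by (auto simp: numeral_2_eq_2)
  have "isCont (\<lambda>t. x + t *\<^sub>R axis i (1::real)) 0" by (intro continuous_intros)
  then have "filterlim (\<lambda>t. x + t *\<^sub>R axis i (1::real)) (nhds x) (nhds 0)"
    by (simp add: tendsto_nhds_iff isCont_def)
  from eventually_compose_filterlim[OF eventually_nhds_in_open[OF assms(1,3)] this]
  have "\<forall>\<^sub>F t in nhds 0. x + t *\<^sub>R axis i 1 \<in> \<Omega>" .
  then have "\<forall>\<^sub>F t in nhds 0. ((\<lambda>t. u (x + t *\<^sub>R axis i 1)) has_real_derivative
      partial_deriv i u (x + t *\<^sub>R axis i 1)) (at t)"
    by eventually_elim (use u differentiable_axis_derivative in blast)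
  then show ?thesis
    unfolding has_second_deriv_def
    using differentiable_axis_derivative[of "partial_deriv i u" x 0 i] u(2)[OF assms(3)]
    by (intro exI[of _ "\<lambda>t. partial_deriv i u (x + t *\<^sub>R axis i 1)"]) auto
qed

lemma differentiable_compose_real:
  fixes u :: "real^'n::finite \<Rightarrow> real"
  assumes "u differentiable (at x)" "(a has_real_derivative a') (at (u x))"
  shows "(\<lambda>y. a (u y)) differentiable (at x)"
proof -
  have "a differentiable (at (u x))"
    using assms(2) by (auto simp: has_field_derivative_def differentiable_def)
  then show ?thesis
    using differentiable_chain_at[OF assms(1)] by (simp add: o_def)
qed

lemma norm_gradient_sq: "(norm (gradient u x))\<^sup>2 = (\<Sum>i\<in>UNIV. (partial_deriv i u x)\<^sup>2)"
  unfolding power2_norm_eq_inner inner_vec_def by (simp add: gradient_def power2_eq_square)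

lemma divergence_form_expand:
  fixes u :: "real^'n::finite \<Rightarrow> real"
  assumes "open \<Omega>" "C_on 2 \<Omega> u" "x \<in> \<Omega>" "(a has_real_derivative a') (at (u x))"
  shows "divergence (\<lambda>y. a (u y) *\<^sub>R gradient u y) x
    = a' * (norm (gradient u x))\<^sup>2 + a (u x) * (\<Sum>i\<in>UNIV. partial_deriv i (partial_deriv i u) x)"
proof -
  have u: "u differentiable (at x)" "partial_deriv i u differentiable (at x)" for i
    using assms(2,3) by (auto simp: numeral_2_eq_2)
  have "partial_deriv i (\<lambda>y. a (u y) * partial_deriv i u y) x
      = a' * (partial_deriv i u x)\<^sup>2 + a (u x) * partial_deriv i (partial_deriv i u) x" for i
  proof (rule partial_deriv_eqI)
    show "(\<lambda>y. a (u y) * partial_deriv i u y) differentiable (at x)"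
      by (intro differentiable_mult differentiable_compose_real[OF u(1) assms(4)] u(2))
    have 1: "((\<lambda>t. u (x + t *\<^sub>R axis i 1)) has_real_derivative partial_deriv i u x) (at 0)"
      using differentiable_axis_derivative[of u x 0 i] u by simp
    have 2: "((\<lambda>t. partial_deriv i u (x + t *\<^sub>R axis i 1)) has_real_derivative
        partial_deriv i (partial_deriv i u) x) (at 0)"
      using differentiable_axis_derivative[of "partial_deriv i u" x 0 i] u by simp
    have 3: "((\<lambda>t. a (u (x + t *\<^sub>R axis i 1))) has_real_derivative a' * partial_deriv i u x) (at 0)"
      using DERIV_chain2[OF _ 1, of a a'] assms(4) by simp
    show "((\<lambda>t. a (u (x + t *\<^sub>R axis i 1)) * partial_deriv i u (x + t *\<^sub>R axis i 1))
        has_real_derivative a' * (partial_deriv i u x)\<^sup>2 + a (u x) * partial_deriv i (partial_deriv i u) x) (at 0)"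
      using DERIV_mult[OF 3 2] by (simp add: power2_eq_square algebra_simps)
  qed
  then show ?thesis
    unfolding divergence_def norm_gradient_sq by (simp add: gradient_def sum.distrib sum_distrib_left)
qed

text \<open>With \<open>G' = \<surd>a\<close> one has \<open>\<Delta>(G \<circ> u) = \<surd>a(u) \<Delta>u + a'(u) / (2 \<surd>a(u)) |Du|\<^sup>2\<close>, which is the
  negative of the left-hand side of the equation divided by \<open>\<surd>a(u)\<close>.\<close>

lemma laplacian_of_transform:
  fixes u :: "real^'n::finite \<Rightarrow> real"
  assumes "open \<Omega>" "C_on 2 \<Omega> u" "x \<in> \<Omega>" "(a has_real_derivative a') (at (u x))"
    and a: "0 < a (u x)"
    and G: "\<forall>\<^sub>F s in nhds (u x). (G has_real_derivative sqrt (a s)) (at s)"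
    and eq: "- divergence (\<lambda>y. a (u y) *\<^sub>R gradient u y) x + a' / 2 * (norm (gradient u x))\<^sup>2 = F"
  shows "has_laplacian (\<lambda>x. G (u x)) (- (F / sqrt (a (u x)))) x"
proof -
  define q where "q = a' / (2 * sqrt (a (u x)))"
  define w where "w i = q * (partial_deriv i u x)\<^sup>2 + sqrt (a (u x)) * partial_deriv i (partial_deriv i u) x" for i
  have "u differentiable (at x)" using assms(2,3) by (auto simp: numeral_2_eq_2)
  then have 1: "((\<lambda>t. u (x + t *\<^sub>R axis i 1)) has_real_derivative partial_deriv i u x) (at 0)" for i
    using differentiable_axis_derivative[of u x 0 i] by simp
  have "((\<lambda>s. sqrt (a s)) has_real_derivative q) (at (u x))"
    using assms(4) a unfolding q_def by (auto intro!: derivative_eq_intros simp: divide_simps)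
  then have "has_second_deriv (\<lambda>t. G (u (x + t *\<^sub>R axis i 1))) (w i) 0" for i
    using has_second_deriv_compose[OF C2_second_deriv[OF assms(1-3), of i] 1, of G "\<lambda>s. sqrt (a s)" q] G
    by (simp add: w_def)
  moreover have "sum w UNIV = - (F / sqrt (a (u x)))"
  proof -
    define T where "T = (\<Sum>i\<in>UNIV. partial_deriv i (partial_deriv i u) x)"
    define n where "n = (norm (gradient u x))\<^sup>2"
    have n: "n = (\<Sum>i\<in>UNIV. (partial_deriv i u x)\<^sup>2)"
      unfolding n_def by (rule norm_gradient_sq)
    have "F = - (a' / 2 * n) - a (u x) * T"
      using eq divergence_form_expand[OF assms(1-4)] by (simp add: n_def T_def)
    moreover have "sum w UNIV = q * n + sqrt (a (u x)) * T"
      by (simp add: w_def n T_def sum.distrib sum_distrib_left)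
    moreover have "sqrt (a (u x)) * sqrt (a (u x)) = a (u x)" using a by simp
    ultimately show ?thesis using a by (simp add: q_def field_simps)
  qed
  ultimately show ?thesis unfolding has_laplacian_def by (intro exI[of _ w]) auto
qed

section \<open>Coefficients of power type\<close>

text \<open>The last property, that \<open>G\<close> does not contract distances, holds because \<open>G' \<ge> 1\<close>. It makes \<open>G\<close>
  injective and turns Lipschitz bounds in \<open>s\<close> into Lipschitz bounds in \<open>G(s)\<close>.\<close>

lemma primitive_of_sqrt:
  fixes a :: "real \<Rightarrow> real"
  assumes "\<And>s. 1 \<le> a s" "continuous_on UNIV a"
  obtains G where "G 0 = 0" "\<And>s. 0 < s \<Longrightarrow> (G has_real_derivative sqrt (a s)) (at s)"
    "continuous_on {0..} G"
    "\<And>s t. 0 \<le> s \<Longrightarrow> s \<le> t \<Longrightarrow> t - s \<le> G t - G s"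
proof -
  define G where "G s = integral {0..s} (\<lambda>s. sqrt (a s))" for s
  have cont: "continuous_on S (\<lambda>s. sqrt (a s))" for S
    by (intro continuous_intros continuous_on_subset[OF assms(2)]) auto
  have within: "(G has_real_derivative sqrt (a s)) (at s within {0..b})" if "s \<in> {0..b}" for s b
    unfolding G_def using integral_has_real_derivative[OF cont that] .
  have der: "(G has_real_derivative sqrt (a s)) (at s)" if "0 < s" for s
    using within[of s "s + 1"] that at_within_Icc_at[of 0 s "s + 1"] by simp
  have contb: "continuous_on {0..b} G" for b
    using within DERIV_continuous continuous_on_eq_continuous_within by blast
  have "continuous_on {0..} G"
    unfolding continuous_on_eq_continuous_within
  proof
    fix s :: real assume "s \<in> {0..}"
    then have "continuous (at s within {0..s + 1}) G"
      using contb[of "s + 1"] by (auto simp: continuous_on_eq_continuous_within)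
    moreover have "at s within {0..s + 1} = at s within {0..}"
      by (rule at_within_nhd[of s "{..<s + 1}"]) auto
    ultimately show "continuous (at s within {0..}) G" by simp
  qed
  moreover have "t - s \<le> G t - G s" if st: "0 \<le> s" "s \<le> t" for s t
  proof (cases "s = t")
    case False
    then have "s < t" using st by simp
    obtain z where "s < z" "z < t" "G t - G s = (t - s) * sqrt (a z)"
    proof -
      have "\<exists>l z. s < z \<and> z < t \<and> DERIV G z :> l \<and> G t - G s = (t - s) * l"
      proof (rule MVT[OF \<open>s < t\<close>])
        show "continuous_on {s..t} G" using st by (intro continuous_on_subset[OF contb[of t]]) auto
        show "G differentiable (at z)" if "s < z" "z < t" for z
          using der[of z] that st real_differentiable_def by fastforce
      qed
      then show ?thesis using that der st DERIV_unique by (metis le_less_trans)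
    qed
    moreover have "1 \<le> sqrt (a z)" using assms(1) by simp
    ultimately show ?thesis using \<open>s < t\<close> by (simp add: mult_le_cancel_left1)
  qed simp
  ultimately show ?thesis using der by (intro that[of G]) (auto simp: G_def)
qed

text \<open>With \<open>b = s\<^sup>k\<close> the derivative of \<open>s\<^sup>p / \<surd>(1 + s\<^sup>k)\<close> is
  \<open>s\<^sup>p\<^sup>-\<^sup>1 (p - (k/2) b/(1+b)) / \<surd>(1+b)\<close>. The bracket lies between \<open>0\<close> and \<open>p\<close>, as \<open>k/2 \<le> p\<close>,
  so that the derivative is bounded by \<open>p M\<^sup>p\<^sup>-\<^sup>1\<close>.\<close>

lemma power_quotient_lipschitz:
  fixes k p :: real
  assumes "1 < k" "k + 1 < p" "0 < s" "s \<le> M" "0 < t" "t \<le> M"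
  defines "f \<equiv> \<lambda>s. s powr p / sqrt (1 + s powr k)"
  shows "\<bar>f s - f t\<bar> \<le> p * M powr (p - 1) * \<bar>s - t\<bar>"
proof -
  define f' where "f' s = (p * s powr (p - 1) * sqrt (1 + s powr k)
      - s powr p * (k * s powr (k - 1) / (2 * sqrt (1 + s powr k)))) / (1 + s powr k)" for s
  have der: "(f has_real_derivative f' s) (at s)" if "0 < s" for s
  proof -
    have pos: "0 < 1 + s powr k" by (simp add: add_pos_nonneg)
    have "((\<lambda>s. 1 + s powr k) has_real_derivative k * s powr (k - 1)) (at s)"
      using that by (auto intro!: derivative_eq_intros)
    from DERIV_chain2[OF DERIV_real_sqrt[OF pos] this]
    have "((\<lambda>s. sqrt (1 + s powr k)) has_real_derivative k * s powr (k - 1) / (2 * sqrt (1 + s powr k))) (at s)"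
      by (simp add: field_simps)
    from DERIV_divide[OF has_real_derivative_powr[OF that, of p] this] pos
    show ?thesis unfolding f_def f'_def by simp
  qed
  have bound: "norm (f' s) \<le> p * M powr (p - 1)" if s: "0 < s" "s \<le> M" for s
  proof -
    define b where "b = s powr k"
    have b: "0 \<le> b" by (simp add: b_def)
    have powers: "s powr p * s powr (k - 1) = s powr (p - 1) * b"
      by (simp add: b_def powr_add[symmetric] algebra_simps)
    have r: "1 \<le> sqrt (1 + b)" using b by simp
    have sq: "sqrt (1 + b) * sqrt (1 + b) = 1 + b" using b by simp
    have "f' s = s powr (p - 1) * (p * sqrt (1 + b) - k / 2 * b / sqrt (1 + b)) / (1 + b)"
      unfolding f'_def b_def[symmetric] using powers by (simp add: field_simps)
    also have "\<dots> = s powr (p - 1) * (p - k / 2 * (b / (1 + b))) / sqrt (1 + b)"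
      using r b sq by (simp add: field_simps)
    finally have eq: "f' s = s powr (p - 1) * (p - k / 2 * (b / (1 + b))) / sqrt (1 + b)" .
    have frac: "0 \<le> b / (1 + b)" "b / (1 + b) \<le> 1" using b by auto
    have "k / 2 * (b / (1 + b)) \<le> k / 2 * 1" using frac assms(1) by (intro mult_left_mono) auto
    moreover have "0 \<le> k / 2 * (b / (1 + b))" using frac(1) assms(1) by (intro mult_nonneg_nonneg) auto
    ultimately have q: "0 \<le> p - k / 2 * (b / (1 + b))" "p - k / 2 * (b / (1 + b)) \<le> p"
      using assms(1,2) by linarith+
    have "\<bar>f' s\<bar> = s powr (p - 1) * (p - k / 2 * (b / (1 + b))) / sqrt (1 + b)"
      unfolding eq using q r by (simp add: abs_mult)
    also have "\<dots> \<le> s powr (p - 1) * (p - k / 2 * (b / (1 + b))) / 1"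
      using q r by (intro divide_left_mono) auto
    also have "\<dots> \<le> M powr (p - 1) * p"
      using q s assms(1,2) by (simp, intro mult_mono powr_mono2) auto
    finally show ?thesis by (simp add: mult.commute)
  qed
  have "norm (f s - f t) \<le> p * M powr (p - 1) * norm (s - t)"
    by (rule field_differentiable_bound[of "{0<..M}" f f'])
       (use assms der bound in \<open>auto intro: has_field_derivative_at_within\<close>)
  then show ?thesis by simp
qed

lemma coefficient_derivative:
  fixes a :: "real \<Rightarrow> real"
  assumes "\<And>s. a s = 1 + \<bar>s\<bar> powr k" "0 < s"
  shows "(a has_real_derivative k * s powr (k - 1)) (at s)"
proof (rule DERIV_cong_ev[THEN iffD1])
  show "((\<lambda>s. 1 + s powr k) has_real_derivative k * s powr (k - 1)) (at s)"
    using assms(2) by (auto intro!: derivative_eq_intros)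
  have "\<forall>\<^sub>F x in nhds s. x \<in> {0<..}" using assms(2) by (intro eventually_nhds_in_open) auto
  then show "\<forall>\<^sub>F x in nhds s. 1 + x powr k = a x" by eventually_elim (simp add: assms(1))
qed auto

theorem theorem3p2:
  fixes \<Omega> :: "(real^'n::finite) set"
    and i1 :: 'n
    and a :: "real \<Rightarrow> real"
    and k p :: real
    and \<psi> u :: "real^'n \<Rightarrow> real"
  assumes "CARD('n) \<ge> 2"
    and "smooth_bounded_domain \<Omega>"
    and "0 \<in> \<Omega>"
    and "reflect i1 ` \<Omega> = \<Omega>"
    and "convex_in_direction i1 \<Omega>"
    and "k > 1"
    and "\<And>s. a s = 1 + \<bar>s\<bar> powr k"
    and "\<And>x. \<psi> x > 0"
    and "continuous_on UNIV \<psi>"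
    and "\<And>x. \<psi> (reflect i1 x) = \<psi> x"
    and "increasing_in_coordinate_on i1 {x \<in> \<Omega>. x $ i1 < 0} \<psi>"
    and "p > k + 1"
    and "classical_solution \<Omega> a \<psi> p u"
  shows "\<forall>x\<in>\<Omega>. u (reflect i1 x) = u x"
proof
  fix x assume "x \<in> \<Omega>"
  have \<Omega>: "open \<Omega>" "bounded \<Omega>" "smooth_boundary \<Omega>"
    using assms(2) by (auto simp: smooth_bounded_domain_def)
  have u: "C_on 2 \<Omega> u" "continuous_on (closure \<Omega>) u"
    and eq: "\<And>x. x \<in> \<Omega> \<Longrightarrow> - divergence (\<lambda>y. a (u y) *\<^sub>R gradient u y) x
              + deriv a (u x) / 2 * (norm (gradient u x))\<^sup>2 = \<psi> x * u x powr p"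
    and pos: "\<And>x. x \<in> \<Omega> \<Longrightarrow> 0 < u x" and zero: "\<And>x. x \<in> frontier \<Omega> \<Longrightarrow> u x = 0"
    using assms(13) by (auto simp: classical_solution_def)
  have nonneg: "0 \<le> u x" if "x \<in> closure \<Omega>" for x
    using pos[of x] zero[of x] that \<Omega>(1) by (cases "x \<in> \<Omega>") (auto simp: frontier_def interior_open)
  have a1: "1 \<le> a s" for s using assms(7) by simp
  have "continuous_on UNIV (\<lambda>s. 1 + \<bar>s\<bar> powr k)"
    using assms(6) by (intro continuous_intros continuous_on_powr') auto
  then have acont: "continuous_on UNIV a" using assms(7) by presburger
  obtain G where G: "G 0 = 0" "\<And>s. 0 < s \<Longrightarrow> (G has_real_derivative sqrt (a s)) (at s)"
    "continuous_on {0..} G" "\<And>s t. 0 \<le> s \<Longrightarrow> s \<le> t \<Longrightarrow> t - s \<le> G t - G s"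
    using primitive_of_sqrt[OF a1 acont] by metis
  have expand: "\<bar>s - t\<bar> \<le> \<bar>G s - G t\<bar>" if "0 \<le> s" "0 \<le> t" for s t
    using G(4)[of s t] G(4)[of t s] that by linarith
  have inj: "inj_on G {0..}"
    by (rule inj_onI) (use expand in fastforce)
  define f where "f s = s powr p / sqrt (1 + s powr k)" for s
  \<comment> \<open>the nonlinearity of the transformed equation, determined by \<open>h (G s) = f s\<close> for \<open>s \<ge> 0\<close>\<close>
  define h where "h = (\<lambda>t. f (inv_into {0..} G t))"
  have h: "h (G s) = f s" if "0 \<le> s" for s
    using inv_into_f_f[OF inj, of s] that by (simp add: h_def)
  have "compact (closure \<Omega>)" using \<Omega>(2) by simp
  then have "bounded (u ` closure \<Omega>)" by (intro compact_imp_bounded compact_continuous_image u(2))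
  then obtain M where M: "\<And>x. x \<in> closure \<Omega> \<Longrightarrow> u x \<le> M"
    unfolding bounded_iff by (metis (lifting) abs_le_D1 imageI real_norm_def)
  define L where "L = p * M powr (p - 1)"
  have L: "0 \<le> L" using assms(6,12) by (simp add: L_def)
  interpret moving_planes \<Omega> i1 \<psi> "\<lambda>x. G (u x)" h L
  proof
    show "continuous_on (closure \<Omega>) (\<lambda>x. G (u x))"
      by (rule continuous_on_compose2[OF G(3) u(2)]) (use nonneg in auto)
    show "0 < G (u x)" if "x \<in> \<Omega>" for x
      using G(4)[of 0 "u x"] G(1) pos[OF that] by simp
    show "G (u x) = 0" if "x \<in> frontier \<Omega>" for x using G(1) zero[OF that] by simp
    show "0 \<le> h (G (u x))" if "x \<in> \<Omega>" for x
      using pos[OF that] by (simp add: h f_def)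
    show "has_laplacian (\<lambda>x. G (u x)) (- (\<psi> x * h (G (u x)))) x" if x: "x \<in> \<Omega>" for x
    proof -
      have ux: "0 < u x" using pos x .
      have da: "(a has_real_derivative k * u x powr (k - 1)) (at (u x))"
        using coefficient_derivative[OF assms(7) ux] .
      have "\<forall>\<^sub>F s in nhds (u x). s \<in> {0<..}" using ux by (intro eventually_nhds_in_open) auto
      then have "\<forall>\<^sub>F s in nhds (u x). (G has_real_derivative sqrt (a s)) (at s)"
        by eventually_elim (use G(2) in auto)
      from laplacian_of_transform[OF \<Omega>(1) u(1) x da _ this] eq[OF x]
      have "has_laplacian (\<lambda>x. G (u x)) (- (\<psi> x * u x powr p / sqrt (a (u x)))) x"
        using a1[of "u x"] DERIV_imp_deriv[OF da] by simp
      then show ?thesis using ux assms(7)[of "u x"] by (simp add: h f_def)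
    qed
    show "L-lipschitz_on ((\<lambda>x. G (u x)) ` \<Omega>) h"
    proof (rule lipschitz_onI[OF _ L], clarify)
      fix x y assume xy: "x \<in> \<Omega>" "y \<in> \<Omega>"
      have "x \<in> closure \<Omega>" "y \<in> closure \<Omega>" using xy closure_subset by auto
      then have "\<bar>f (u x) - f (u y)\<bar> \<le> L * \<bar>u x - u y\<bar>"
        unfolding f_def L_def using assms(6,12) pos xy M by (intro power_quotient_lipschitz) auto
      also have "\<dots> \<le> L * \<bar>G (u x) - G (u y)\<bar>"
        using L expand pos xy by (intro mult_left_mono) (auto simp: less_imp_le)
      finally show "dist (h (G (u x))) (h (G (u y))) \<le> L * dist (G (u x)) (G (u y))"
        using pos xy by (simp add: h less_imp_le dist_real_def)
    qed
  qed (use \<Omega> assms smooth_boundary_corkscrew in \<open>auto\<close>)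
  have "G (u (reflect i1 x)) = G (u x)" using reflection_symmetry \<open>x \<in> \<Omega>\<close> .
  moreover have "reflect i1 x \<in> \<Omega>" using \<open>x \<in> \<Omega>\<close> assms(4) by blast
  ultimately show "u (reflect i1 x) = u x"
    using inj_onD[OF inj] pos \<open>x \<in> \<Omega>\<close> by (simp add: less_imp_le)
qed

end
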